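(* Let $G=(V,E)$ be a $d$-regular connected graph for some $d\ge 3$. Then the simple random walk on $G$ is recurrent if and only if the non-backtracking random walk on $G$ is recurrent.
   Context: Graphs are simple (no loops, no multiple edges). The simple random walk on $G$ is the Markov chain on $V$ with $P(x,y)=\mathbf 1\{\{x,y\}\in E\}/\deg(x)$. The non-backtracking random walk (NBRW) $(X_t)_{t\ge0}$ started from a vertex $u$: the first step is a simple random walk step from $u$; given $(X_i)_{i=0}^{t+1}$, $X_{t+2}$ is uniform on $\{z: \{z,X_{t+1}\}\in E,\ z\ne X_t\}$ (and if this set is empty, $X_{t+2}=X_t$). A vertex $v$ is recurrent for a given type of walk if the walk started from $v$ returns to $v$ infinitely often almost surely; otherwise it is transient. The walk on $G$ is recurrent if all vertices are recurrent for it. *)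

theory Defs
  imports "HOL-Probability.Probability"
begin

text \<open>
  A graph \<open>(V, E)\<close> is given by its vertex set and its set of edges, each edge being a
  two-element set of vertices. \<open>V\<close> may be infinite.
\<close>

definition simple_graph :: "'a set \<Rightarrow> 'a set set \<Rightarrow> bool" where
  "simple_graph V E \<longleftrightarrow> (\<forall>e\<in>E. \<exists>x\<in>V. \<exists>y\<in>V. x \<noteq> y \<and> e = {x, y})"

definition neighbours :: "'a set set \<Rightarrow> 'a \<Rightarrow> 'a set" where
  "neighbours E x = {y. {x, y} \<in> E}"

definition deg :: "'a set set \<Rightarrow> 'a \<Rightarrow> nat" where
  "deg E x = card (neighbours E x)"

text \<open>The finiteness clause rules out infinite neighbourhoods, whose \<open>card\<close> is \<open>0\<close>.\<close>

definition regular_graph :: "'a set \<Rightarrow> 'a set set \<Rightarrow> nat \<Rightarrow> bool" where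
  "regular_graph V E d \<longleftrightarrow> (\<forall>x\<in>V. finite (neighbours E x) \<and> deg E x = d)"

definition connected_graph :: "'a set \<Rightarrow> 'a set set \<Rightarrow> bool" where
  "connected_graph V E \<longleftrightarrow> (\<forall>x\<in>V. \<forall>y\<in>V. (x, y) \<in> {(a, b). {a, b} \<in> E}\<^sup>*)"

text \<open>
  The law on \<open>nat \<Rightarrow> 'a\<close> of the \<open>V\<close>-valued process whose value at time \<open>n\<close>, given its past
  \<open>\<omega> 0, \<dots>, \<omega> (n - 1)\<close>, has distribution \<open>K n \<omega>\<close>: the Ionescu-Tulcea extension of the kernels
  \<open>K\<close>. It is meaningful when \<open>Ionescu_Tulcea K (\<lambda>_. count_space V)\<close> holds; for the two walks
  below on a connected locally finite graph without isolated vertices this is shown at the end.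
\<close>

definition process_law :: "'a set \<Rightarrow> (nat \<Rightarrow> (nat \<Rightarrow> 'a) \<Rightarrow> 'a measure) \<Rightarrow> (nat \<Rightarrow> 'a) measure" where
  "process_law V K =
     projective_family.lim UNIV (Ionescu_Tulcea.CI K (\<lambda>_. count_space V)) (\<lambda>_. count_space V)"

definition srw_prob :: "'a set set \<Rightarrow> 'a \<Rightarrow> 'a \<Rightarrow> real" where
  "srw_prob E x y = (if {x, y} \<in> E then 1 else 0) / real (deg E x)"

definition srw_step :: "'a set \<Rightarrow> 'a set set \<Rightarrow> 'a \<Rightarrow> 'a measure" where
  "srw_step V E x = point_measure V (\<lambda>y. ennreal (srw_prob E x y))"

fun srw_kernel :: "'a set \<Rightarrow> 'a set set \<Rightarrow> 'a \<Rightarrow> nat \<Rightarrow> (nat \<Rightarrow> 'a) \<Rightarrow> 'a measure" where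
  "srw_kernel V E u 0 \<omega> = return (count_space V) u"
| "srw_kernel V E u (Suc t) \<omega> = srw_step V E (\<omega> t)"

text \<open>One step of the non-backtracking walk that has just moved from \<open>x\<close> to \<open>y\<close>.\<close>

definition nbrw_step :: "'a set \<Rightarrow> 'a set set \<Rightarrow> 'a \<Rightarrow> 'a \<Rightarrow> 'a measure" where
  "nbrw_step V E x y =
     (let Z = {z. {z, y} \<in> E \<and> z \<noteq> x}
      in if Z = {} then return (count_space V) x else uniform_measure (count_space V) Z)"

fun nbrw_kernel :: "'a set \<Rightarrow> 'a set set \<Rightarrow> 'a \<Rightarrow> nat \<Rightarrow> (nat \<Rightarrow> 'a) \<Rightarrow> 'a measure" where
  "nbrw_kernel V E u 0 \<omega> = return (count_space V) u"
| "nbrw_kernel V E u (Suc 0) \<omega> = srw_step V E (\<omega> 0)"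
| "nbrw_kernel V E u (Suc (Suc t)) \<omega> = nbrw_step V E (\<omega> t) (\<omega> (Suc t))"

definition srw :: "'a set \<Rightarrow> 'a set set \<Rightarrow> 'a \<Rightarrow> (nat \<Rightarrow> 'a) measure" where
  "srw V E u = process_law V (srw_kernel V E u)"

definition nbrw :: "'a set \<Rightarrow> 'a set set \<Rightarrow> 'a \<Rightarrow> (nat \<Rightarrow> 'a) measure" where
  "nbrw V E u = process_law V (nbrw_kernel V E u)"

text \<open>A type of walk \<open>W\<close> assigns to each starting vertex the law of the walk started there.\<close>

definition recurrent_vertex :: "('a \<Rightarrow> (nat \<Rightarrow> 'a) measure) \<Rightarrow> 'a \<Rightarrow> bool" where
  "recurrent_vertex W v \<longleftrightarrow> (AE \<omega> in W v. \<exists>\<^sub>\<infinity>t. \<omega> t = v)"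

definition recurrent_walk :: "'a set \<Rightarrow> ('a \<Rightarrow> (nat \<Rightarrow> 'a) measure) \<Rightarrow> bool" where
  "recurrent_walk V W \<longleftrightarrow> (\<forall>v\<in>V. recurrent_vertex W v)"


lemma neighbours_subset: "simple_graph V E \<Longrightarrow> neighbours E x \<subseteq> V"
  unfolding simple_graph_def neighbours_def by (fastforce simp: doubleton_eq_iff)

lemma countable_vertices:
  assumes "simple_graph V E" "connected_graph V E" "\<And>x. x \<in> V \<Longrightarrow> finite (neighbours E x)"
  shows "countable V"
proof (cases "V = {}")
  case False
  then obtain v where v: "v \<in> V" by auto
  define B where "B n = ((\<lambda>S. \<Union>x\<in>S. neighbours E x) ^^ n) {v}" for n :: nat
  have B: "finite (B n) \<and> B n \<subseteq> V" for n
  proof (induction n)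
    case (Suc n)
    then show ?case using assms(3) neighbours_subset[OF assms(1)]
      by (auto simp: B_def)
  qed (auto simp: B_def v)
  have "V \<subseteq> (\<Union>n. B n)"
  proof
    fix y assume "y \<in> V"
    then have "(v, y) \<in> {(a, b). {a, b} \<in> E}\<^sup>*"
      using assms(2) v by (auto simp: connected_graph_def)
    then show "y \<in> (\<Union>n. B n)"
    proof (induction rule: rtrancl_induct)
      case base
      have "v \<in> B 0" by (simp add: B_def)
      then show ?case by blast
    next
      case (step y z)
      then obtain n where "y \<in> B n" by auto
      with step have "z \<in> B (Suc n)" by (auto simp: B_def neighbours_def)
      then show ?case by blast
    qed
  qed
  moreover have "countable (\<Union>n. B n)"
    using B by (auto intro: countable_finite)
  ultimately show ?thesis by (rule countable_subset)
qed simp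

lemma prob_space_srw_step:
  assumes "simple_graph V E" "finite (neighbours E x)" "neighbours E x \<noteq> {}"
  shows "prob_space (srw_step V E x)"
proof (rule prob_spaceI)
  have eq: "ennreal (srw_prob E x y) = ennreal (1 / deg E x) * indicator (neighbours E x) y" for y
    by (auto simp: srw_prob_def neighbours_def)
  have "emeasure (srw_step V E x) (space (srw_step V E x)) =
        (\<integral>\<^sup>+ y. ennreal (srw_prob E x y) * indicator V y \<partial>count_space V)"
    unfolding srw_step_def point_measure_def by (subst emeasure_density) auto
  also have "\<dots> = (\<integral>\<^sup>+ y. ennreal (1 / deg E x) * indicator (neighbours E x) y \<partial>count_space V)"
    by (intro nn_integral_cong) (auto simp: eq)
  also have "\<dots> = ennreal (1 / deg E x) * of_nat (deg E x)"
    using neighbours_subset[OF assms(1), of x] assms(2)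
    by (subst nn_integral_cmult_indicator) (auto simp: emeasure_count_space deg_def)
  also have "\<dots> = 1"
    using assms(2,3) by (simp add: deg_def ennreal_of_nat_eq_real_of_nat flip: ennreal_mult)
  finally show "emeasure (srw_step V E x) (space (srw_step V E x)) = 1" .
qed

lemma prob_space_nbrw_step:
  assumes "simple_graph V E" "finite (neighbours E y)" "x \<in> V"
  shows "prob_space (nbrw_step V E x y)"
proof -
  let ?Z = "{z. {z, y} \<in> E \<and> z \<noteq> x}"
  have sub: "?Z \<subseteq> neighbours E y"
    by (auto simp: neighbours_def insert_commute)
  then have "?Z \<subseteq> V" "finite ?Z"
    using neighbours_subset[OF assms(1)] assms(2) by (blast, auto intro: finite_subset)
  then show ?thesis
    using assms(3) unfolding nbrw_step_def Let_def
    by (auto intro!: prob_space_return prob_space_uniform_measure simp: emeasure_count_space)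
qed

lemma Ionescu_Tulcea_discreteI:
  assumes "countable V"
    and "\<And>i \<omega>. (\<And>j. j < i \<Longrightarrow> \<omega> j \<in> V) \<Longrightarrow> prob_space (K i \<omega>) \<and> sets (K i \<omega>) = Pow V"
  shows "Ionescu_Tulcea K (\<lambda>_. count_space V)"
proof (rule Ionescu_Tulcea.intro)
  fix i :: nat
  have eq: "PiM {0..<i} (\<lambda>_. count_space V) = count_space (PiE {0..<i} (\<lambda>_. V))"
    using assms(1) by (intro count_space_PiM_finite) auto
  have K: "prob_space (K i \<omega>)" "sets (K i \<omega>) = Pow V" if "\<omega> \<in> PiE {0..<i} (\<lambda>_. V)" for \<omega>
    using assms(2)[of i \<omega>] that by (auto simp: PiE_iff)
  show "K i \<in> PiM {0..<i} (\<lambda>_. count_space V) \<rightarrow>\<^sub>M subprob_algebra (count_space V)"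
    unfolding eq
    by (auto simp: space_subprob_algebra K intro!: prob_space_imp_subprob_space)
  fix x assume "x \<in> space (PiM {0..<i} (\<lambda>_. count_space V))"
  then show "prob_space (K i x)"
    using K by (simp add: eq)
qed

lemma walk_kernels:
  assumes "simple_graph V E" "connected_graph V E" "u \<in> V"
    and "\<And>x. x \<in> V \<Longrightarrow> finite (neighbours E x) \<and> neighbours E x \<noteq> {}"
  shows Ionescu_Tulcea_srw: "Ionescu_Tulcea (srw_kernel V E u) (\<lambda>_. count_space V)"
    and Ionescu_Tulcea_nbrw: "Ionescu_Tulcea (nbrw_kernel V E u) (\<lambda>_. count_space V)"
proof -
  have V: "countable V"
    using assms by (intro countable_vertices) auto
  note p = prob_space_srw_step[OF assms(1)] prob_space_nbrw_step[OF assms(1)]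
  have s: "sets (srw_step V E x) = Pow V" "sets (nbrw_step V E x y) = Pow V" for x y
    by (auto simp: srw_step_def nbrw_step_def point_measure_def Let_def)
  have r: "prob_space (return (count_space V) u)"
    using assms(3) by (intro prob_space_return) auto
  show "Ionescu_Tulcea (srw_kernel V E u) (\<lambda>_. count_space V)"
  proof (rule Ionescu_Tulcea_discreteI[OF V])
    fix i and \<omega> :: "nat \<Rightarrow> 'a" assume "\<And>j. j < i \<Longrightarrow> \<omega> j \<in> V"
    then show "prob_space (srw_kernel V E u i \<omega>) \<and> sets (srw_kernel V E u i \<omega>) = Pow V"
      using assms(4) by (cases i) (auto simp: r s intro!: p)
  qed
  show "Ionescu_Tulcea (nbrw_kernel V E u) (\<lambda>_. count_space V)"
  proof (rule Ionescu_Tulcea_discreteI[OF V])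
    fix i and \<omega> :: "nat \<Rightarrow> 'a" assume "\<And>j. j < i \<Longrightarrow> \<omega> j \<in> V"
    then show "prob_space (nbrw_kernel V E u i \<omega>) \<and> sets (nbrw_kernel V E u i \<omega>) = Pow V"
      using assms(4) by (cases "(V, E, u, i, \<omega>)" rule: nbrw_kernel.cases) (auto simp: r s intro!: p)
  qed
qed

end

theory Submission
  imports Defs
begin

text \<open>
  The non-backtracking walk is a Markov chain on arcs \<open>(x, y)\<close>. For a function \<open>h\<close> on arcs with
  \<open>h (x, y) = k x + Q h (x, y)\<close>, where \<open>Q\<close> averages over the \<open>d - 1\<close> continuations of an arc, the
  average \<open>H x\<close> of \<open>h\<close> over the arcs leaving \<open>x\<close> satisfies \<open>(1 - P) (H - k / d) = (d - 2) / d * k\<close>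
  with \<open>P\<close> the simple random walk operator. With \<open>k\<close> the indicator of \<open>v\<close> this relates the Green
  functions of the two walks at \<open>v\<close>, so that one is finite iff the other is. If the Green function
  of the simple walk is finite, the expected number of visits of the non-backtracking walk is
  bounded, hence it is transient. If the simple walk is recurrent, its nonnegative superharmonic
  functions are constant, so the Green function on arcs is infinite and some arc out of \<open>v\<close> is
  recurrent. With \<open>k = 0\<close> and \<open>h\<close> the probability of visiting \<open>v\<close> infinitely often, \<open>H\<close> is harmonic
  and thus constant; since \<open>d \<noteq> 2\<close>, so is \<open>h\<close>, and it equals \<open>1\<close> on the recurrent arc.
\<close>

section \<open>Visits of a chain that moves to a uniformly chosen successor\<close>

definition average :: "('s \<Rightarrow> 's set) \<Rightarrow> ('s \<Rightarrow> real) \<Rightarrow> 's \<Rightarrow> real" where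
  "average nb f x = (\<Sum>y\<in>nb x. f y) / real (card (nb x))"

text \<open>
  For the chain that jumps from \<open>x\<close> to a uniform element of \<open>nb x\<close>, \<open>visits_prob nb B N k x\<close> is the
  probability, starting at \<open>x\<close>, of at least \<open>k\<close> visits to \<open>B\<close> at times \<open>0, \<dots>, N - 1\<close>, and
  \<open>visits_mean nb B N x\<close> the expected number of these visits. The subtraction in the recursion is
  truncated: the requirement of \<open>0\<close> visits is preserved. The probability of infinitely many visits
  is \<open>visits_inf\<close>.
\<close>

primrec visits_prob :: "('s \<Rightarrow> 's set) \<Rightarrow> 's set \<Rightarrow> nat \<Rightarrow> nat \<Rightarrow> 's \<Rightarrow> real" where
  "visits_prob nb B 0 = (\<lambda>k x. of_bool (k = 0))"
| "visits_prob nb B (Suc N) =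
     (\<lambda>k x. average nb (visits_prob nb B N (k - of_bool (x \<in> B))) x)"

definition visits_lim :: "('s \<Rightarrow> 's set) \<Rightarrow> 's set \<Rightarrow> nat \<Rightarrow> 's \<Rightarrow> real" where
  "visits_lim nb B k x = lim (\<lambda>N. visits_prob nb B N k x)"

definition visits_inf :: "('s \<Rightarrow> 's set) \<Rightarrow> 's set \<Rightarrow> 's \<Rightarrow> real" where
  "visits_inf nb B x = lim (\<lambda>k. visits_lim nb B k x)"

primrec visits_mean :: "('s \<Rightarrow> 's set) \<Rightarrow> 's set \<Rightarrow> nat \<Rightarrow> 's \<Rightarrow> real" where
  "visits_mean nb B 0 = (\<lambda>x. 0)"
| "visits_mean nb B (Suc N) = (\<lambda>x. of_bool (x \<in> B) + average nb (visits_mean nb B N) x)"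

section \<open>Averages over a successor set\<close>

lemma average_cong: "(\<And>y. y \<in> nb x \<Longrightarrow> f y = g y) \<Longrightarrow> average nb f x = average nb g x"
  by (simp add: average_def)

lemma average_add: "average nb (\<lambda>y. f y + g y) x = average nb f x + average nb g x"
  by (simp add: average_def sum.distrib add_divide_distrib)

lemma average_diff: "average nb (\<lambda>y. f y - g y) x = average nb f x - average nb g x"
  by (simp add: average_def sum_subtractf diff_divide_distrib)

lemma average_cmult: "average nb (\<lambda>y. c * f y) x = c * average nb f x"
  by (simp add: average_def sum_distrib_left)

lemma average_sum: "average nb (\<lambda>y. \<Sum>b\<in>B. f b y) x = (\<Sum>b\<in>B. average nb (f b) x)"
  unfolding average_def by (subst sum.swap) (simp add: sum_divide_distrib)

lemma average_nonneg: "(\<And>y. y \<in> nb x \<Longrightarrow> 0 \<le> f y) \<Longrightarrow> 0 \<le> average nb f x"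
  by (auto simp: average_def intro!: divide_nonneg_nonneg sum_nonneg)

lemma average_mono: "(\<And>y. y \<in> nb x \<Longrightarrow> f y \<le> g y) \<Longrightarrow> average nb f x \<le> average nb g x"
  by (auto simp: average_def intro!: divide_right_mono sum_mono)

lemma average_tendsto:
  "(\<And>y. y \<in> nb x \<Longrightarrow> (\<lambda>n. f n y) \<longlonglongrightarrow> g y) \<Longrightarrow> (\<lambda>n. average nb (f n) x) \<longlonglongrightarrow> average nb g x"
  unfolding average_def
  by (cases "card (nb x) = 0") (auto intro!: tendsto_intros)

section \<open>Monotonicity of visit probabilities and means\<close>

lemma visits_prob_nonneg: "0 \<le> visits_prob nb B N k x"
  by (induction N arbitrary: k x) (auto intro: average_nonneg)

lemma visits_prob_antimono: "k \<le> l \<Longrightarrow> visits_prob nb B N l x \<le> visits_prob nb B N k x"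
  by (induction N arbitrary: k l x) (auto intro!: average_mono)

lemma visits_prob_mono_target: "A \<subseteq> B \<Longrightarrow> visits_prob nb A N k x \<le> visits_prob nb B N k x"
proof (induction N arbitrary: k x)
  case (Suc N)
  have "k - of_bool (x \<in> B) \<le> k - of_bool (x \<in> A)"
    using Suc.prems by auto
  from order_trans[OF visits_prob_antimono[OF this] Suc.IH[OF Suc.prems]]
  show ?case by (simp add: average_mono)
qed auto

lemma visits_mean_nonneg: "0 \<le> visits_mean nb B N x"
  by (induction N arbitrary: x) (auto intro!: average_nonneg add_nonneg_nonneg)

lemma visits_mean_sum:
  "finite B \<Longrightarrow> visits_mean nb B N x = (\<Sum>b\<in>B. visits_mean nb {b} N x)"
proof (induction N arbitrary: x)
  case (Suc N)
  have "(\<Sum>b\<in>B. of_bool (x = b)) = (of_bool (x \<in> B) :: real)"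
    using Suc.prems by (simp add: of_bool_def sum.delta)
  then show ?case
    using Suc by (simp add: sum.distrib Suc.IH[OF Suc.prems, abs_def] flip: average_sum)
qed auto

lemma visits_mean_mono_Suc: "visits_mean nb B N x \<le> visits_mean nb B (Suc N) x"
  by (induction N arbitrary: x) (auto intro!: average_mono average_nonneg add_nonneg_nonneg)

section \<open>Limits of visit probabilities for chains with finite nonempty successor sets\<close>

locale finite_chain =
  fixes S :: "'s set" and nb :: "'s \<Rightarrow> 's set"
  assumes finite_nb: "x \<in> S \<Longrightarrow> finite (nb x)"
    and nb_nonempty: "x \<in> S \<Longrightarrow> nb x \<noteq> {}"
    and nb_subset: "x \<in> S \<Longrightarrow> nb x \<subseteq> S"
begin

lemma average_const: "x \<in> S \<Longrightarrow> average nb (\<lambda>_. c) x = c"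
  using finite_nb nb_nonempty by (simp add: average_def card_gt_0_iff)

lemma average_eqI: "x \<in> S \<Longrightarrow> (\<And>y. y \<in> nb x \<Longrightarrow> f y = c) \<Longrightarrow> average nb f x = c"
  by (subst average_cong[where g = "\<lambda>_. c"]) (simp_all add: average_const)

text \<open>One step of the maximum principle: the deficits \<open>c - f y\<close> are nonnegative
  and sum to zero.\<close>

lemma average_eq_upper:
  assumes "x \<in> S" "\<And>y. y \<in> nb x \<Longrightarrow> f y \<le> c" "average nb f x = c" "y \<in> nb x"
  shows "f y = c"
proof -
  have "(\<Sum>y\<in>nb x. c - f y) = 0"
    using assms(1,3) finite_nb[of x] nb_nonempty[of x]
    by (simp add: average_def sum_subtractf field_simps card_gt_0_iff split: if_splits)
  then have "\<forall>y\<in>nb x. c - f y = 0"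
    using assms(1,2) finite_nb by (subst (asm) sum_nonneg_eq_0_iff) auto
  then show ?thesis using assms(4) by simp
qed

lemma visits_prob_0: "x \<in> S \<Longrightarrow> visits_prob nb B N 0 x = 1"
proof (induction N arbitrary: x)
  case (Suc N)
  then have "average nb (visits_prob nb B N 0) x = average nb (\<lambda>_. 1) x"
    using nb_subset by (intro average_cong) auto
  then show ?case using Suc.prems by (simp add: average_const)
qed auto

lemma visits_prob_le_1: "x \<in> S \<Longrightarrow> visits_prob nb B N k x \<le> 1"
  using visits_prob_antimono[of 0 k nb B N x] by (simp add: visits_prob_0)

text \<open>Markov's inequality for the number of visits, derived from the two recursions alone:
  passing from \<open>k\<close> to the truncated \<open>l\<close> loses at most the visit that the
  mean counts at \<open>x\<close>.\<close>

lemma visits_prob_le_mean: "x \<in> S \<Longrightarrow> real k * visits_prob nb B N k x \<le> visits_mean nb B N x"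
proof (induction N arbitrary: k x)
  case (Suc N)
  define l where "l = k - of_bool (x \<in> B)"
  have "real l * average nb (visits_prob nb B N l) x \<le> average nb (visits_mean nb B N) x"
    using Suc nb_subset[of x] by (subst average_cmult[symmetric]) (auto intro!: average_mono)
  moreover have "real k \<le> of_bool (x \<in> B) + real l"
    by (auto simp: l_def)
  then have "real k * visits_prob nb B (Suc N) k x
      \<le> (of_bool (x \<in> B) + real l) * visits_prob nb B (Suc N) k x"
    by (intro mult_right_mono visits_prob_nonneg)
  moreover have "of_bool (x \<in> B) * visits_prob nb B (Suc N) k x \<le> of_bool (x \<in> B)"
    by (intro mult_left_le visits_prob_le_1 Suc.prems) auto
  ultimately show ?case by (simp add: l_def[symmetric] distrib_right)
qed auto

lemma visits_prob_mono_Suc: "x \<in> S \<Longrightarrow> visits_prob nb B N k x \<le> visits_prob nb B (Suc N) k x"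
proof (induction N arbitrary: k x)
  case 0
  then show ?case 
    using visits_prob_nonneg[of nb B 1 k x] visits_prob_0[of x B 1] by (cases "k = 0") auto
next
  case (Suc N)
  have "average nb (visits_prob nb B N (k - of_bool (x \<in> B))) x
     \<le> average nb (visits_prob nb B (Suc N) (k - of_bool (x \<in> B))) x"
    using Suc nb_subset[of x] by (intro average_mono) blast
  then show ?case by simp
qed

lemma visits_lim:
  assumes "x \<in> S"
  shows "(\<lambda>N. visits_prob nb B N k x) \<longlonglongrightarrow> visits_lim nb B k x"
proof -
  have "incseq (\<lambda>N. visits_prob nb B N k x)"
    using visits_prob_mono_Suc[OF assms] by (intro incseq_SucI)
  then show ?thesis
    unfolding visits_lim_def convergent_LIMSEQ_iff[symmetric]
    by (intro Bseq_monoseq_convergent BseqI'[of _ 1])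
       (auto simp: monoseq_iff visits_prob_le_1[OF assms] visits_prob_nonneg)
qed

lemma visits_lim_upper: "x \<in> S \<Longrightarrow> visits_prob nb B N k x \<le> visits_lim nb B k x"
  by (rule incseq_le[OF incseq_SucI visits_lim]) (rule visits_prob_mono_Suc)

lemma visits_lim_rec:
  assumes "x \<in> S"
  shows "visits_lim nb B k x = average nb (visits_lim nb B (k - of_bool (x \<in> B))) x"
proof (rule LIMSEQ_unique)
  show "(\<lambda>N. visits_prob nb B (Suc N) k x) \<longlonglongrightarrow> visits_lim nb B k x"
    using visits_lim[OF assms] by (rule LIMSEQ_Suc)
  show "(\<lambda>N. visits_prob nb B (Suc N) k x) \<longlonglongrightarrow> average nb (visits_lim nb B (k - of_bool (x \<in> B))) x"
    using nb_subset[OF assms] by (auto intro!: average_tendsto visits_lim)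
qed

lemma visits_lim_le: "x \<in> S \<Longrightarrow> (\<And>N. visits_prob nb B N k x \<le> c) \<Longrightarrow> visits_lim nb B k x \<le> c"
  using visits_lim[of x B k] by (intro LIMSEQ_le_const2) auto

lemma visits_lim_le_1: "x \<in> S \<Longrightarrow> visits_lim nb B k x \<le> 1"
  by (intro visits_lim_le visits_prob_le_1)

lemma visits_lim_nonneg: "x \<in> S \<Longrightarrow> 0 \<le> visits_lim nb B k x"
  using visits_lim_upper[of x B 0 k] visits_prob_nonneg[of nb B 0 k x] by linarith

lemma visits_lim_0: "x \<in> S \<Longrightarrow> visits_lim nb B 0 x = 1"
  using visits_lim[of x B 0] by (simp add: visits_prob_0 LIMSEQ_const_iff)

lemma visits_lim_antimono: "x \<in> S \<Longrightarrow> k \<le> l \<Longrightarrow> visits_lim nb B l x \<le> visits_lim nb B k x"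
  by (rule visits_lim_le, assumption) (rule order_trans[OF visits_prob_antimono visits_lim_upper])

lemma visits_inf:
  assumes "x \<in> S"
  shows "(\<lambda>k. visits_lim nb B k x) \<longlonglongrightarrow> visits_inf nb B x"
proof -
  have "decseq (\<lambda>k. visits_lim nb B k x)"
    using visits_lim_antimono[OF assms] by (simp add: decseq_def)
  then show ?thesis
    unfolding visits_inf_def convergent_LIMSEQ_iff[symmetric]
    by (intro Bseq_monoseq_convergent BseqI'[of _ 1])
       (auto simp: monoseq_iff visits_lim_le_1[OF assms] visits_lim_nonneg[OF assms])
qed

lemma visits_inf_lower: "x \<in> S \<Longrightarrow> visits_inf nb B x \<le> visits_lim nb B k x"
  by (rule decseq_ge[OF decseq_SucI visits_inf]) (auto intro: visits_lim_antimono)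

lemma visits_inf_nonneg: "x \<in> S \<Longrightarrow> 0 \<le> visits_inf nb B x"
  by (rule LIMSEQ_le_const[OF visits_inf]) (auto intro: visits_lim_nonneg)

lemma visits_inf_le_1: "x \<in> S \<Longrightarrow> visits_inf nb B x \<le> 1"
  by (rule order_trans[OF visits_inf_lower visits_lim_le_1])

lemma visits_inf_eq_1_iff:
  assumes "x \<in> S"
  shows "visits_inf nb B x = 1 \<longleftrightarrow> (\<forall>k. visits_lim nb B k x = 1)"
proof
  assume "visits_inf nb B x = 1"
  then show "\<forall>k. visits_lim nb B k x = 1"
    using visits_inf_lower[OF assms, of B] visits_lim_le_1[OF assms, of B] by (simp add: order_antisym)
next
  assume "\<forall>k. visits_lim nb B k x = 1"
  then show "visits_inf nb B x = 1"
    using visits_inf[OF assms, of B] by (simp add: LIMSEQ_const_iff)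
qed

text \<open>A visit at \<open>x\<close> only shifts \<open>k\<close> by one, and the shift
  disappears as \<open>k\<close> tends to infinity. Hence harmonicity holds on \<open>B\<close> as
  well.\<close>

lemma visits_inf_harmonic:
  assumes "x \<in> S"
  shows "average nb (visits_inf nb B) x = visits_inf nb B x"
proof (rule LIMSEQ_unique)
  let ?b = "of_bool (x \<in> B)"
  have "(\<lambda>k. average nb (visits_lim nb B k) x) \<longlonglongrightarrow> average nb (visits_inf nb B) x"
    using nb_subset[OF assms] by (auto intro!: average_tendsto visits_inf)
  also have "(\<lambda>k. average nb (visits_lim nb B k) x) = (\<lambda>k. visits_lim nb B (k + ?b) x)"
    using visits_lim_rec[OF assms, of B] by (simp add: fun_eq_iff)
  finally show "(\<lambda>k. visits_lim nb B (k + ?b) x) \<longlonglongrightarrow> average nb (visits_inf nb B) x" .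
  show "(\<lambda>k. visits_lim nb B (k + ?b) x) \<longlonglongrightarrow> visits_inf nb B x"
    using visits_inf[OF assms] by (rule LIMSEQ_ignore_initial_segment)
qed

lemma visits_lim_mono_target: "x \<in> S \<Longrightarrow> A \<subseteq> B \<Longrightarrow> visits_lim nb A k x \<le> visits_lim nb B k x"
  by (rule visits_lim_le, assumption) (rule order_trans[OF visits_prob_mono_target visits_lim_upper])

lemma visits_inf_mono_target:
  assumes "x \<in> S" "A \<subseteq> B"
  shows "visits_inf nb A x \<le> visits_inf nb B x"
  using visits_lim_mono_target[OF assms]
  by (intro LIMSEQ_le[OF visits_inf[OF assms(1)] visits_inf[OF assms(1)]]) auto

text \<open>Averaging fixes constants, so \<open>g + C\<close> is nonnegative and dominates its own
  recursion; the iteration for \<open>visits_mean\<close> starts at 0 and stays below it. This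
  admits solutions \<open>g\<close> of unknown sign.\<close>

lemma visits_mean_le_solution:
  assumes "\<And>x. x \<in> S \<Longrightarrow> g x = of_bool (x \<in> B) + average nb g x"
    and "\<And>x. x \<in> S \<Longrightarrow> - C \<le> g x" and "x \<in> S"
  shows "visits_mean nb B N x \<le> g x + C"
  using assms(3)
proof (induction N arbitrary: x)
  case 0
  then show ?case using assms(2)[of x] by simp
next
  case (Suc N)
  then have "average nb (visits_mean nb B N) x \<le> average nb (\<lambda>y. g y + C) x"
    using nb_subset by (intro average_mono) auto
  then show ?case
    using Suc.prems assms(1)[of x] by (simp add: average_add average_const)
qed

text \<open>The chain never leaves \<open>S\<close>. This makes the target
  \<open>{v} \<times> UNIV\<close> a finite set of arcs, to which \<open>visits_mean_sum\<close>
  applies.\<close>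

lemma visits_mean_restrict_target: "x \<in> S \<Longrightarrow> visits_mean nb (B \<inter> S) N x = visits_mean nb B N x"
proof (induction N arbitrary: x)
  case (Suc N)
  then have "average nb (visits_mean nb (B \<inter> S) N) x = average nb (visits_mean nb B N) x"
    using nb_subset[OF Suc.prems] by (intro average_cong) auto
  then show ?case using Suc.prems by simp
qed auto

text \<open>The Green function as the limit of an increasing bounded sequence; its equation is the
  limit of the recursion.\<close>

lemma visits_mean_limit:
  assumes "\<And>x N. x \<in> S \<Longrightarrow> visits_mean nb B N x \<le> c x"
  obtains g where "\<And>x. x \<in> S \<Longrightarrow> g x = of_bool (x \<in> B) + average nb g x"
    and "\<And>x. x \<in> S \<Longrightarrow> 0 \<le> g x" and "\<And>x. x \<in> S \<Longrightarrow> g x \<le> c x"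
proof
  define g where "g x = lim (\<lambda>N. visits_mean nb B N x)" for x
  have lim: "(\<lambda>N. visits_mean nb B N x) \<longlonglongrightarrow> g x" if "x \<in> S" for x
    unfolding g_def convergent_LIMSEQ_iff[symmetric]
  proof (rule Bseq_monoseq_convergent)
    show "Bseq (\<lambda>N. visits_mean nb B N x)"
      using assms[OF that] visits_mean_nonneg[of nb B _ x] by (intro BseqI'[of _ "c x"]) auto
    have "incseq (\<lambda>N. visits_mean nb B N x)"
      by (intro incseq_SucI visits_mean_mono_Suc)
    then show "monoseq (\<lambda>N. visits_mean nb B N x)" by (simp add: monoseq_iff)
  qed
  fix x assume x: "x \<in> S"
  show "0 \<le> g x" by (rule LIMSEQ_le_const[OF lim[OF x]]) (auto intro: visits_mean_nonneg)
  show "g x \<le> c x" by (rule LIMSEQ_le_const2[OF lim[OF x]]) (auto intro: assms x)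
  show "g x = of_bool (x \<in> B) + average nb g x"
  proof (rule LIMSEQ_unique)
    show "(\<lambda>N. visits_mean nb B (Suc N) x) \<longlonglongrightarrow> g x"
      using lim[OF x] by (rule LIMSEQ_Suc)
    show "(\<lambda>N. visits_mean nb B (Suc N) x) \<longlonglongrightarrow> of_bool (x \<in> B) + average nb g x"
      using nb_subset[OF x] lim by (auto intro!: tendsto_intros average_tendsto)
  qed
qed

text \<open>By Markov's inequality at least \<open>k + 1\<close> visits have probability at most
  \<open>C / (k + 1)\<close>.\<close>

lemma visits_inf_eq_0:
  assumes "x \<in> S" "\<And>N. visits_mean nb B N x \<le> C"
  shows "visits_inf nb B x = 0"
proof -
  have "visits_inf nb B x \<le> C / real (Suc k)" for k
  proof -
    have "visits_lim nb B (Suc k) x \<le> C / real (Suc k)"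
    proof (rule visits_lim_le[OF assms(1)])
      fix N
      have "real (Suc k) * visits_prob nb B N (Suc k) x \<le> C"
        by (rule order_trans[OF visits_prob_le_mean[OF assms(1)] assms(2)])
      then show "visits_prob nb B N (Suc k) x \<le> C / real (Suc k)"
        by (simp add: field_simps del: of_nat_Suc)
    qed
    then show ?thesis using visits_inf_lower[OF assms(1), of B "Suc k"] by simp
  qed
  moreover have "(\<lambda>k. C / real (Suc k)) \<longlonglongrightarrow> 0"
    using LIMSEQ_Suc[OF lim_const_over_n] .
  ultimately have "visits_inf nb B x \<le> 0"
    by (intro LIMSEQ_le_const) auto
  then show ?thesis using visits_inf_nonneg[OF assms(1)] by (simp add: order_antisym)
qed

text \<open>Optional stopping at the first visit to \<open>v\<close>: the factor of
  \<open>u v\<close> is the probability of hitting \<open>v\<close> before time \<open>N\<close>.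
  Off \<open>v\<close> the inequality passes through the average; at \<open>v\<close> it holds
  because a probability is at most 1.\<close>

lemma superharmonic_ge:
  assumes u: "\<And>x. x \<in> S \<Longrightarrow> 0 \<le> u x" "\<And>x. x \<in> S \<Longrightarrow> average nb u x \<le> u x" and "v \<in> S" "x \<in> S"
  shows "visits_prob nb {v} N (Suc 0) x * u v \<le> u x"
  using \<open>x \<in> S\<close>
proof (induction N arbitrary: x)
  case (Suc N)
  show ?case
  proof (cases "x = v")
    case True
    then show ?thesis
      using u(1)[OF \<open>v \<in> S\<close>] visits_prob_le_1[OF \<open>v \<in> S\<close>, of "{v}" "Suc N" "Suc 0"]
      by (simp del: visits_prob.simps add: mult_left_le_one_le visits_prob_nonneg)
  next
    case False
    have "u v * average nb (visits_prob nb {v} N (Suc 0)) x \<le> average nb u x"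
      using Suc nb_subset[of x]
      by (subst average_cmult[symmetric]) (auto intro!: average_mono simp: mult.commute)
    then show ?thesis using u(2)[OF Suc.prems] False by (simp add: mult.commute)
  qed
qed (use u in auto)

section \<open>Returns to a single point\<close>

context
  fixes v assumes v: "v \<in> S"
begin

lemma visits_lim_point_1: "visits_lim nb {v} (Suc 0) v = 1"
proof -
  have "average nb (visits_lim nb {v} 0) v = 1"
    using nb_subset[OF v] by (intro average_eqI[OF v] visits_lim_0) auto
  then show ?thesis using visits_lim_rec[OF v, of "{v}" "Suc 0"] by simp
qed

text \<open>The strong Markov property at the first visit to \<open>v\<close>, without stopping
  times. The upper bound is an induction on the horizon; the lower bound is
  \<open>superharmonic_ge\<close> for \<open>visits_lim nb {v} (Suc k)\<close>, which is
  superharmonic because lowering the requirement raises the probability.\<close>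

lemma visits_lim_point_mult:
  assumes "x \<in> S"
  shows "visits_lim nb {v} (Suc k) x = visits_lim nb {v} (Suc 0) x * visits_lim nb {v} (Suc k) v"
proof (rule antisym)
  let ?r = "visits_lim nb {v} (Suc k) v"
  have "visits_prob nb {v} N (Suc k) x \<le> visits_prob nb {v} N (Suc 0) x * ?r" for N
    using assms
  proof (induction N arbitrary: x)
    case (Suc N)
    show ?case
    proof (cases "x = v")
      case True
      have "visits_prob nb {v} (Suc N) (Suc 0) v = 1"
        using v nb_subset[OF v] by (auto intro!: average_eqI visits_prob_0)
      then show ?thesis
        using visits_lim_upper[OF v, of "{v}" "Suc N" "Suc k"] True by simp
    next
      case False
      have "average nb (visits_prob nb {v} N (Suc k)) x
          \<le> ?r * average nb (visits_prob nb {v} N (Suc 0)) x"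
        using Suc nb_subset[of x]
        by (subst average_cmult[symmetric]) (auto intro!: average_mono simp: mult.commute)
      then show ?thesis using False by (simp add: mult.commute)
    qed
  qed auto
  then show "visits_lim nb {v} (Suc k) x \<le> visits_lim nb {v} (Suc 0) x * ?r"
    by (intro LIMSEQ_le[OF visits_lim[OF assms] tendsto_mult_right[OF visits_lim[OF assms]]]) auto
  have "visits_prob nb {v} N (Suc 0) x * ?r \<le> visits_lim nb {v} (Suc k) x" for N
  proof (rule superharmonic_ge[OF _ _ v assms])
    fix x assume "x \<in> S"
    then show "0 \<le> visits_lim nb {v} (Suc k) x" by (rule visits_lim_nonneg)
    have "average nb (visits_lim nb {v} (Suc k)) x
      \<le> average nb (visits_lim nb {v} (Suc k - of_bool (x \<in> {v}))) x"
      using nb_subset[OF \<open>x \<in> S\<close>] by (intro average_mono visits_lim_antimono) auto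
    then show "average nb (visits_lim nb {v} (Suc k)) x \<le> visits_lim nb {v} (Suc k) x"
      using visits_lim_rec[OF \<open>x \<in> S\<close>, of "{v}" "Suc k"] by simp
  qed
  moreover have "(\<lambda>N. visits_prob nb {v} N (Suc 0) x * ?r) \<longlonglongrightarrow> visits_lim nb {v} (Suc 0) x * ?r"
    using visits_lim[OF assms] by (intro tendsto_intros)
  ultimately show "visits_lim nb {v} (Suc 0) x * ?r \<le> visits_lim nb {v} (Suc k) x"
    by (intro LIMSEQ_le_const2) auto
qed

text \<open>The base of the power is the return probability to \<open>v\<close>; each further visit
  contributes one factor.\<close>

lemma visits_lim_point_power:
  "visits_lim nb {v} (Suc k) v = average nb (visits_lim nb {v} (Suc 0)) v ^ k"
proof (induction k)
  case 0
  then show ?case by (simp add: visits_lim_point_1)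
next
  case (Suc k)
  have "visits_lim nb {v} (Suc (Suc k)) v = average nb (visits_lim nb {v} (Suc k)) v"
    using v by (subst visits_lim_rec) auto
  also have "\<dots> = average nb (\<lambda>x. visits_lim nb {v} (Suc k) v * visits_lim nb {v} (Suc 0) x) v"
    using nb_subset[OF v] by (intro average_cong, subst mult.commute, intro visits_lim_point_mult) auto
  finally show ?case by (simp add: average_cmult Suc power_Suc2 del: power_Suc)
qed

text \<open>Each return to \<open>v\<close> has the same probability \<open>a\<close>, so the number of visits is geometric if \<open>a < 1\<close>.\<close>

lemma visits_dichotomy:
  "visits_inf nb {v} v = 1 \<or> (\<exists>C. \<forall>N. \<forall>x\<in>S. visits_mean nb {v} N x \<le> C)"
proof -
  define a where "a = average nb (visits_lim nb {v} (Suc 0)) v"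
  have "a \<le> average nb (\<lambda>_. 1) v"
    unfolding a_def using nb_subset[OF v] by (intro average_mono visits_lim_le_1) auto
  then have "a \<le> 1" using v by (simp add: average_const)
  moreover have "0 \<le> a"
    unfolding a_def using nb_subset[OF v] by (intro average_nonneg visits_lim_nonneg) auto
  ultimately consider "a = 1" | "0 \<le> a" "a < 1" by linarith
  then show ?thesis
  proof cases
    case 1
    then have "visits_lim nb {v} k v = 1" for k
      using visits_lim_point_power visits_lim_0[OF v] by (cases k) (auto simp: a_def)
    then show ?thesis using v by (simp add: visits_inf_eq_1_iff)
  next
    case 2
    \<comment> \<open>The mean of the geometric number of visits from \<open>v\<close>.\<close>
    define C where "C = 1 / (1 - a)"
    have C: "C = 1 + C * a" "C \<ge> 0" using 2 by (auto simp: C_def field_simps)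
    \<comment> \<open>Carrying the hitting probability makes the bound inductive: off
      \<open>v\<close> it is preserved by averaging, and at \<open>v\<close> it becomes
      \<open>C = 1 + C * a\<close>.\<close>
    have "visits_mean nb {v} N x \<le> C * visits_lim nb {v} (Suc 0) x" if "x \<in> S" for N x
      using that
    proof (induction N arbitrary: x)
      case 0
      then show ?case using C visits_lim_nonneg by simp
    next
      case (Suc N)
      have *: "average nb (visits_mean nb {v} N) x \<le> C * average nb (visits_lim nb {v} (Suc 0)) x"
        using Suc nb_subset[of x] by (subst average_cmult[symmetric]) (auto intro!: average_mono)
      show ?case
      proof (cases "x = v")
        case True
        then show ?thesis using * C(1) visits_lim_point_1 by (simp add: a_def)
      next
        case False
        then show ?thesis using * visits_lim_rec[OF Suc.prems, of "{v}" "Suc 0"] by simp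
      qed
    qed
    moreover have "C * visits_lim nb {v} (Suc 0) x \<le> C" if "x \<in> S" for x
      using C that by (intro mult_left_le visits_lim_le_1)
    ultimately show ?thesis by (intro disjI2 exI[of _ C] allI ballI) (rule order_trans)
  qed
qed

end

end

section \<open>Green functions on vertices and on arcs\<close>

text \<open>The arc at time \<open>n\<close> consists of the positions at times \<open>n\<close> and
  \<open>n + 1\<close>, so the walk is at its first component, and visits to \<open>v\<close> are
  visits to \<open>{v} \<times> UNIV\<close>.\<close>

definition arc_nb :: "'a set set \<Rightarrow> 'a \<times> 'a \<Rightarrow> ('a \<times> 'a) set" where
  "arc_nb E a = {snd a} \<times> (neighbours E (snd a) - {fst a})"

definition arcs :: "'a set \<Rightarrow> 'a set set \<Rightarrow> ('a \<times> 'a) set" where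
  "arcs V E = (SIGMA x:V. neighbours E x)"

lemma neighbours_sym: "y \<in> neighbours E x \<longleftrightarrow> x \<in> neighbours E y"
  by (simp add: neighbours_def insert_commute)

section \<open>The vertex chain and the arc chain of a connected regular graph\<close>

locale connected_regular_graph =
  fixes V :: "'a set" and E :: "'a set set" and d :: nat
  assumes simple: "simple_graph V E"
    and d_ge_3: "d \<ge> 3"
    and regular: "regular_graph V E d"
    and connected: "connected_graph V E"
begin

abbreviation nbs :: "'a \<Rightarrow> 'a set" where "nbs \<equiv> neighbours E"
abbreviation anb :: "'a \<times> 'a \<Rightarrow> ('a \<times> 'a) set" where "anb \<equiv> arc_nb E"

lemma finite_nbs: "x \<in> V \<Longrightarrow> finite (nbs x)"
  using regular by (simp add: regular_graph_def)

lemma card_nbs: "x \<in> V \<Longrightarrow> card (nbs x) = d"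
  using regular by (simp add: regular_graph_def deg_def)

lemma nbs_subset: "nbs x \<subseteq> V"
  using neighbours_subset[OF simple] .

lemma nbs_in: "y \<in> nbs x \<Longrightarrow> y \<in> V"
  using nbs_subset by blast

lemma nbs_nonempty: "x \<in> V \<Longrightarrow> nbs x \<noteq> {}"
  using card_nbs[of x] d_ge_3 by auto

text \<open>Since \<open>d\<close> exceeds 1, no arc is a dead end and the fallback in
  \<open>nbrw_step\<close> never occurs.\<close>

lemma nbs_diff_nonempty: "x \<in> V \<Longrightarrow> nbs x - {y} \<noteq> {}"
proof
  assume "x \<in> V" "nbs x - {y} = {}"
  then have "card (nbs x) \<le> card {y}" by (intro card_mono) auto
  with card_nbs[OF \<open>x \<in> V\<close>] d_ge_3 show False by simp
qed

sublocale srw: finite_chain V nbs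
  by standard (use finite_nbs nbs_nonempty nbs_subset in auto)

sublocale nbrw: finite_chain "arcs V E" anb
proof
  fix a assume "a \<in> arcs V E"
  then have *: "snd a \<in> V" using nbs_in by (auto simp: arcs_def)
  show "finite (anb a)" using finite_nbs[OF *] by (simp add: arc_nb_def)
  show "anb a \<noteq> {}" using nbs_diff_nonempty[OF *, of "fst a"] by (auto simp: arc_nb_def)
  show "anb a \<subseteq> arcs V E" using * by (auto simp: arc_nb_def arcs_def)
qed

text \<open>The first step of the non-backtracking walk is uniform on the arcs out of its start, so
  this converts a quantity for a starting arc into one for a starting vertex.\<close>

definition out_avg :: "('a \<times> 'a \<Rightarrow> real) \<Rightarrow> 'a \<Rightarrow> real" where
  "out_avg h x = average nbs (\<lambda>y. h (x, y)) x"

lemma sum_nbs: "x \<in> V \<Longrightarrow> (\<Sum>y\<in>nbs x. f y) = d * average nbs f x"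
  using d_ge_3 by (simp add: average_def card_nbs)

lemma average_anb_eq:
  "average anb h (x, y) = (\<Sum>z\<in>nbs y - {x}. h (y, z)) / real (card (nbs y - {x}))"
proof -
  have "anb (x, y) = Pair y ` (nbs y - {x})" by (auto simp: arc_nb_def)
  then show ?thesis by (simp add: average_def sum.reindex card_image inj_on_def)
qed

text \<open>The continuations of \<open>(x, y)\<close> are all arcs out of \<open>y\<close> except
  the reversal. This couples the values on an arc and on its reversal to the vertex
  averages.\<close>

lemma average_anb:
  assumes "x \<in> V" "y \<in> nbs x"
  shows "(real d - 1) * average anb h (x, y) = d * out_avg h y - h (y, x)"
proof -
  have y: "y \<in> V" "x \<in> nbs y" using assms nbs_in neighbours_sym by metis+
  have "average anb h (x, y) = (\<Sum>z\<in>nbs y - {x}. h (y, z)) / real (card (nbs y - {x}))"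
    by (rule average_anb_eq)
  also have "(\<Sum>z\<in>nbs y - {x}. h (y, z)) = d * out_avg h y - h (y, x)"
    using y finite_nbs by (simp add: sum_diff1 sum_nbs out_avg_def)
  also have "real (card (nbs y - {x})) = real d - 1"
    using y d_ge_3 by (simp add: card_Diff_singleton card_nbs of_nat_diff)
  finally show ?thesis using d_ge_3 by simp
qed

text \<open>The equation for \<open>h\<close> at \<open>(x, y)\<close> and at \<open>(y, x)\<close>, each averaged over \<open>y\<close>, eliminates the terms \<open>h (y, x)\<close>.\<close>

lemma out_avg_laplacian:
  fixes h :: "'a \<times> 'a \<Rightarrow> real" and k :: "'a \<Rightarrow> real"
  assumes h: "\<And>x y. x \<in> V \<Longrightarrow> y \<in> nbs x \<Longrightarrow> h (x, y) = k x + average anb h (x, y)" and x: "x \<in> V"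
  shows "average nbs (\<lambda>y. out_avg h y - k y / d) x = out_avg h x - k x / d - (real d - 2) / d * k x"
proof -
  have 1: "(real d - 1) * (h (x, y) - k x) = d * out_avg h y - h (y, x)"
    and 2: "(real d - 1) * (h (y, x) - k y) = d * out_avg h x - h (x, y)" if "y \<in> nbs x" for y
  proof -
    have "y \<in> V" "x \<in> nbs y" using that nbs_in neighbours_sym by metis+
    then show "(real d - 1) * (h (x, y) - k x) = d * out_avg h y - h (y, x)"
      "(real d - 1) * (h (y, x) - k y) = d * out_avg h x - h (x, y)"
      using h[OF x that] h[of y x] average_anb[OF x that, of h] average_anb[of y x h] by simp_all
  qed
  \<comment> \<open>\<open>R\<close> averages over the arcs into \<open>x\<close> and is to be
    eliminated: averaging 2 gives \<open>R = average nbs k x + H\<close>.\<close>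
  define H R where "H = out_avg h x" and "R = average nbs (\<lambda>y. h (y, x)) x"
  have "(real d - 1) * (H - k x) = d * average nbs (out_avg h) x - R"
  proof -
    have "(real d - 1) * (H - k x) = average nbs (\<lambda>y. (real d - 1) * (h (x, y) - k x)) x"
      by (simp add: average_cmult average_diff H_def out_avg_def srw.average_const[OF x])
    also have "\<dots> = average nbs (\<lambda>y. d * out_avg h y - h (y, x)) x"
      by (intro average_cong 1)
    finally show ?thesis by (simp add: average_cmult average_diff R_def)
  qed
  moreover have "(real d - 1) * (R - average nbs k x) = d * H - H"
  proof -
    have "(real d - 1) * (R - average nbs k x) = average nbs (\<lambda>y. (real d - 1) * (h (y, x) - k y)) x"
      by (simp add: average_cmult average_diff R_def)
    also have "\<dots> = average nbs (\<lambda>y. d * out_avg h x - h (x, y)) x"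
      by (intro average_cong 2)
    finally show ?thesis by (simp add: average_diff H_def srw.average_const[OF x]) (simp add: out_avg_def)
  qed
  then have "(real d - 1) * (R - average nbs k x) = (real d - 1) * H"
    by (simp add: algebra_simps)
  then have "R = average nbs k x + H" using d_ge_3 by simp
  ultimately have "d * average nbs (out_avg h) x - average nbs k x = d * H - (real d - 1) * k x"
    by (simp add: algebra_simps)
  moreover have "d * average nbs (\<lambda>y. out_avg h y - k y / d) x
      = d * average nbs (out_avg h) x - average nbs k x"
    using average_cmult[of nbs "1 / d" k x] d_ge_3 by (simp add: average_diff right_diff_distrib)
  moreover have "d * (H - k x / d - (real d - 2) / d * k x) = d * H - (real d - 1) * k x"
    using d_ge_3 by (simp add: field_simps)
  ultimately have "d * average nbs (\<lambda>y. out_avg h y - k y / d) x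
      = d * (H - k x / d - (real d - 2) / d * k x)" by simp
  then show ?thesis
    using d_ge_3 unfolding H_def by simp
qed

text \<open>The bounded Green function \<open>G\<close> of the simple walk yields an explicit
  solution \<open>g\<close> of the Green equation on arcs. As \<open>g\<close> is bounded below, the
  expected number of visits from each arc is bounded.\<close>

lemma nbrw_transient:
  assumes v: "v \<in> V" and "visits_inf nbs {v} v \<noteq> 1" and a: "a \<in> arcs V E"
  shows "visits_inf anb ({v} \<times> UNIV) a = 0"
proof -
  let ?k = "\<lambda>x. of_bool (x = v) :: real"
  obtain C where "\<And>x N. x \<in> V \<Longrightarrow> visits_mean nbs {v} N x \<le> C"
    using srw.visits_dichotomy[OF v] assms(2) by blast
  then obtain G where G: "\<And>x. x \<in> V \<Longrightarrow> G x = ?k x + average nbs G x"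
    and G0: "\<And>x. x \<in> V \<Longrightarrow> 0 \<le> G x" and GC: "\<And>x. x \<in> V \<Longrightarrow> G x \<le> C"
    using srw.visits_mean_limit[of "{v}" "\<lambda>_. C"] by auto
  \<comment> \<open>\<open>K\<close> is the value of \<open>out_avg g\<close> forced by \<open>out_avg_laplacian\<close>; given \<open>K\<close>, the equations for
    \<open>g (x, y)\<close> and \<open>g (y, x)\<close> are a linear system of determinant \<open>(d - 1)\<^sup>2 - 1 = d (d - 2)\<close>.
    The solution is bounded, but its sign is not evident, hence only a lower bound is used.\<close>
  define K where "K x = ((real d - 2) * G x + ?k x) / d" for x
  define g where "g a = (case a of (x, y) \<Rightarrow> ((real d - 1) * ((real d - 1) * ?k x + d * K y)
      - (real d - 1) * ?k y - d * K x) / (d * (real d - 2)))" for a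
  have d: "real d \<ge> 3" using d_ge_3 by simp
  \<comment> \<open>Consistency of the construction: \<open>g\<close> was built from a prescribed
    outgoing average, and the equation for \<open>G\<close> shows that it has this average.\<close>
  have out: "out_avg g x = K x" if x: "x \<in> V" for x
  proof -
    let ?A = "average nbs ?k x"
    have avgK: "average nbs K x = ((real d - 2) * (G x - ?k x) + ?A) / d"
      using G[OF x] average_cmult[of nbs "1 / d" "\<lambda>y. (real d - 2) * G y + ?k y" x]
      by (simp add: K_def[abs_def] average_add average_cmult)
    have "out_avg g x = average nbs (\<lambda>y. (1 / (d * (real d - 2))) * (
        ((real d - 1) * (real d - 1) * ?k x - d * K x) + ((real d - 1) * d) * K y - (real d - 1) * ?k y)) x"
      unfolding out_avg_def
      by (intro average_cong) (simp add: g_def algebra_simps diff_divide_distrib add_divide_distrib)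
    also have "\<dots> = (1 / (d * (real d - 2))) * (
        ((real d - 1) * (real d - 1) * ?k x - d * K x) + ((real d - 1) * d) * average nbs K x - (real d - 1) * ?A)"
      by (simp only: average_cmult average_diff average_add srw.average_const[OF x])
    also have "\<dots> = K x"
    proof -
      have k: "?k x = d * K x - (real d - 2) * G x"
        using d by (simp add: K_def)
      show ?thesis unfolding avgK k using d by (simp add: field_simps)
    qed
    finally show ?thesis .
  qed
  have rec: "g a = of_bool (a \<in> {v} \<times> UNIV) + average anb g a" if "a \<in> arcs V E" for a
  proof -
    obtain x y where [simp]: "a = (x, y)" by fastforce
    have xy: "x \<in> V" "y \<in> nbs x" "y \<in> V" using that nbs_in by (auto simp: arcs_def)
    have "(real d - 1) * average anb g (x, y) = d * K y - g (y, x)"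
      using average_anb[OF xy(1,2), of g] out[OF xy(3)] by simp
    also have "\<dots> = (real d - 1) * (g (x, y) - ?k x)"
      using d by (simp add: g_def field_simps)
    finally show ?thesis using d by simp
  qed
  have K0: "0 \<le> K x" "d * K x \<le> (real d - 2) * C + 1" if "x \<in> V" for x
  proof -
    have "0 \<le> (real d - 2) * G x" "(real d - 2) * G x \<le> (real d - 2) * C"
      using d G0[OF that] GC[OF that] by (auto intro: mult_left_mono)
    moreover have "d * K x = (real d - 2) * G x + ?k x" using d by (simp add: K_def)
    moreover have "0 \<le> ?k x" "?k x \<le> 1" by auto
    ultimately show "d * K x \<le> (real d - 2) * C + 1" by linarith
    show "0 \<le> K x" using \<open>0 \<le> (real d - 2) * G x\<close> by (simp add: K_def)
  qed
  \<comment> \<open>The first summand bounds the term with \<open>?k y\<close>, the second bounds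
    \<open>d * K x\<close> by \<open>K0\<close>; the remaining terms of \<open>g\<close> are
    nonnegative.\<close>
  define M where "M = ((real d - 1) + ((real d - 2) * C + 1)) / (d * (real d - 2))"
  have lower: "- M \<le> g a" if "a \<in> arcs V E" for a
  proof -
    obtain x y where [simp]: "a = (x, y)" by fastforce
    have xy: "x \<in> V" "y \<in> nbs x" "y \<in> V" using that nbs_in by (auto simp: arcs_def)
    have "0 \<le> (real d - 1) * ((real d - 1) * ?k x + d * K y)"
      using d K0(1)[OF xy(3)] by (intro mult_nonneg_nonneg add_nonneg_nonneg) auto
    moreover have "(real d - 1) * ?k y \<le> (real d - 1)" using d by auto
    ultimately have "- ((real d - 1) + ((real d - 2) * C + 1))
        \<le> (real d - 1) * ((real d - 1) * ?k x + d * K y) - (real d - 1) * ?k y - d * K x"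
      using K0(2)[OF xy(1)] by linarith
    then have "- ((real d - 1) + ((real d - 2) * C + 1)) / (d * (real d - 2)) \<le> g a"
      using d unfolding g_def by (simp only: prod.case \<open>a = (x, y)\<close>) (intro divide_right_mono, auto)
    then show ?thesis by (simp only: M_def minus_divide_left)
  qed
  have "visits_mean anb ({v} \<times> UNIV) N a \<le> g a + M" for N
    by (rule nbrw.visits_mean_le_solution[OF rec lower a])
  then show ?thesis by (rule nbrw.visits_inf_eq_0[OF a])
qed

section \<open>Consequences of recurrence of the simple walk\<close>

context
  assumes recurrent: "\<And>v. v \<in> V \<Longrightarrow> visits_inf nbs {v} v = 1"
begin

text \<open>The hitting probability attains its maximum 1 at \<open>v\<close>, and the maximum
  principle spreads this value along paths.\<close>

lemma srw_hits:
  assumes "v \<in> V" "x \<in> V"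
  shows "visits_lim nbs {v} (Suc 0) x = 1"
proof -
  let ?f = "visits_lim nbs {v} (Suc 0)"
  have *: "visits_lim nbs {v} k v = 1" for k
    using recurrent[OF assms(1)] srw.visits_inf_eq_1_iff[OF assms(1)] by simp
  have "(v, x) \<in> {(a, b). {a, b} \<in> E}\<^sup>*"
    using connected assms by (simp add: connected_graph_def)
  then have "x \<in> V \<and> ?f x = 1"
  proof (induction rule: rtrancl_induct)
    case base
    then show ?case using * assms by simp
  next
    case (step y z)
    then have y: "y \<in> V" "?f y = 1" by simp_all
    have z: "z \<in> nbs y" using step(2) by (simp add: neighbours_def)
    have "average nbs ?f y = 1"
    proof (cases "y = v")
      \<comment> \<open>At \<open>v\<close> the requirement of one visit is met at once and says
        nothing about the neighbours; two visits leave one for them.\<close>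
      case True
      then show ?thesis
        using *[of "Suc (Suc 0)"] srw.visits_lim_rec[OF y(1), of "{v}" "Suc (Suc 0)"] by simp
    next
      case False
      then show ?thesis
        using y srw.visits_lim_rec[OF y(1), of "{v}" "Suc 0"] by simp
    qed
    then show ?case
      using z nbs_in by (auto intro!: srw.average_eq_upper[OF y(1)] srw.visits_lim_le_1)
  qed
  then show ?thesis by simp
qed

text \<open>Since \<open>v\<close> is hit with probability 1, \<open>superharmonic_ge\<close> gives
  \<open>u v \<le> u x\<close> in the limit; the roles of the points can be exchanged.\<close>

lemma srw_superharmonic_const:
  assumes u: "\<And>x. x \<in> V \<Longrightarrow> 0 \<le> u x" "\<And>x. x \<in> V \<Longrightarrow> average nbs u x \<le> u x"
    and "x \<in> V" "y \<in> V"
  shows "u x = u y"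
proof -
  have "u v \<le> u x" if "v \<in> V" "x \<in> V" for v x
  proof -
    have "(\<lambda>N. visits_prob nbs {v} N (Suc 0) x * u v) \<longlonglongrightarrow> visits_lim nbs {v} (Suc 0) x * u v"
      by (intro tendsto_intros srw.visits_lim that)
    then show ?thesis
      using srw.superharmonic_ge[OF u that] srw_hits[OF that] by (auto intro: LIMSEQ_le_const2)
  qed
  then show ?thesis using assms(3,4) by (simp add: order_antisym)
qed

text \<open>Otherwise the dichotomy bounds the visits to each arc out of \<open>v\<close>, and the
  total Green function \<open>g\<close> is finite. It induces a nonnegative superharmonic
  \<open>u\<close> on vertices, which is then constant, although its average at \<open>v\<close> is
  smaller than its value by \<open>(d - 2) / d\<close>.\<close>

lemma nbrw_recurrent_arc:
  assumes v: "v \<in> V"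
  shows "\<exists>w\<in>nbs v. visits_inf anb {(v, w)} (v, w) = 1"
proof (rule ccontr)
  assume *: "\<not> (\<exists>w\<in>nbs v. visits_inf anb {(v, w)} (v, w) = 1)"
  have arc: "(v, w) \<in> arcs V E" if "w \<in> nbs v" for w using that v by (simp add: arcs_def)
  have "\<forall>w\<in>nbs v. \<exists>C. \<forall>N. \<forall>x\<in>arcs V E. visits_mean anb {(v, w)} N x \<le> C"
    using nbrw.visits_dichotomy[OF arc] * by blast
  then obtain C where C: "\<And>w N x. w \<in> nbs v \<Longrightarrow> x \<in> arcs V E \<Longrightarrow> visits_mean anb {(v, w)} N x \<le> C w"
    by metis
  have "({v} \<times> UNIV) \<inter> arcs V E = Pair v ` nbs v"
    using v by (auto simp: arcs_def)
  then have "visits_mean anb ({v} \<times> UNIV) N a = visits_mean anb (Pair v ` nbs v) N a"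
    if "a \<in> arcs V E" for a N
    using nbrw.visits_mean_restrict_target[OF that, of "{v} \<times> UNIV" N] by simp
  also have "visits_mean anb (Pair v ` nbs v) N a = (\<Sum>w\<in>nbs v. visits_mean anb {(v, w)} N a)" for a N
    using finite_nbs[OF v] by (subst visits_mean_sum) (simp_all add: sum.reindex inj_on_def)
  finally have "visits_mean anb ({v} \<times> UNIV) N a \<le> (\<Sum>w\<in>nbs v. C w)" if "a \<in> arcs V E" for a N
    using that C by (simp add: sum_mono)
  then obtain g where g: "\<And>a. a \<in> arcs V E \<Longrightarrow> g a = of_bool (a \<in> {v} \<times> UNIV) + average anb g a"
    and g0: "\<And>a. a \<in> arcs V E \<Longrightarrow> 0 \<le> g a"
    using nbrw.visits_mean_limit[of "{v} \<times> UNIV" "\<lambda>_. \<Sum>w\<in>nbs v. C w"] by metis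
  define k :: "'a \<Rightarrow> real" where "k x = of_bool (x = v)" for x
  \<comment> \<open>The correction by \<open>k x / d\<close> is the one in
    \<open>out_avg_laplacian\<close>. It keeps \<open>u\<close> nonnegative because \<open>g\<close>
    includes the visit at time 0, so that \<open>out_avg g\<close> is at least
    \<open>k\<close>.\<close>
  define u where "u x = out_avg g x - k x / d" for x
  have g1: "g (x, y) = k x + average anb g (x, y)" if "x \<in> V" "y \<in> nbs x" for x y
    using g[of "(x, y)"] that by (simp add: arcs_def k_def)
  have lap: "average nbs u x = u x - (real d - 2) / d * k x" if "x \<in> V" for x
    unfolding u_def using out_avg_laplacian[OF g1 that] by simp
  have "k x \<le> out_avg g x" if "x \<in> V" for x
  proof -
    have "average nbs (\<lambda>_. k x) x \<le> out_avg g x"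
      unfolding out_avg_def
    proof (rule average_mono)
      fix y assume y: "y \<in> nbs x"
      have xy: "(x, y) \<in> arcs V E" using that y by (simp add: arcs_def)
      have "0 \<le> average anb g (x, y)"
        using nbrw.nb_subset[OF xy] by (intro average_nonneg g0) auto
      then show "k x \<le> g (x, y)" using g1[OF that y] by simp
    qed
    then show ?thesis by (simp add: srw.average_const[OF that])
  qed
  moreover have "k x / d \<le> k x" for x using d_ge_3 by (simp add: k_def)
  ultimately have u0: "0 \<le> u x" if "x \<in> V" for x
    unfolding u_def using that by (meson diff_ge_0_iff_ge order_trans)
  have "average nbs u x \<le> u x" if "x \<in> V" for x
    using lap[OF that] d_ge_3 by (simp add: k_def)
  with u0 have const: "u x = u v" if "x \<in> V" for x
    using srw_superharmonic_const[of u x v] that v by blast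
  have "average nbs u v = u v"
    using nbs_subset by (intro srw.average_eqI[OF v] const) auto
  then show False using lap[OF v] d_ge_3 by (simp add: k_def)
qed

text \<open>A Liouville argument takes the place of irreducibility of the arc chain:
  \<open>h\<close> is constant on all arcs, so its value on one recurrent arc decides.\<close>

lemma nbrw_recurrent:
  assumes v: "v \<in> V" and a: "a \<in> arcs V E"
  shows "visits_inf anb ({v} \<times> UNIV) a = 1"
proof -
  define h where "h = visits_inf anb ({v} \<times> UNIV)"
  have h: "h (x, y) = 0 + average anb h (x, y)" if "x \<in> V" "y \<in> nbs x" for x y
    using that by (simp add: h_def nbrw.visits_inf_harmonic arcs_def)
  have "average nbs (out_avg h) x = out_avg h x" if "x \<in> V" for x
    using out_avg_laplacian[of h "\<lambda>_. 0", OF h that] by simp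
  moreover have "0 \<le> out_avg h x" if "x \<in> V" for x
    using that by (auto simp: out_avg_def h_def arcs_def intro!: average_nonneg nbrw.visits_inf_nonneg)
  ultimately have out: "out_avg h x = out_avg h v" if "x \<in> V" for x
    using srw_superharmonic_const[of "out_avg h" x v] that v by simp
  define c where "c = out_avg h v"
  have h_const: "h (x, y) = c" if "x \<in> V" "y \<in> nbs x" for x y
  proof -
    have yx: "y \<in> V" "x \<in> nbs y" using that nbs_in neighbours_sym by metis+
    have 1: "(real d - 1) * h (x, y) = d * c - h (y, x)"
      using average_anb[OF that, of h] h[OF that] out[OF yx(1)] by (simp add: c_def)
    have 2: "(real d - 1) * h (y, x) = d * c - h (x, y)"
      using average_anb[OF yx, of h] h[OF yx] out[OF that(1)] by (simp add: c_def)
    \<comment> \<open>The difference of 1 and 2; for \<open>d = 2\<close> the two orientations could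
      carry different values.\<close>
    have "(real d - 2) * (h (x, y) - h (y, x)) = 0"
      using 1 2 by (simp add: algebra_simps)
    then have "h (x, y) = h (y, x)" using d_ge_3 by simp
    with 1 have "d * h (x, y) = d * c" by (simp add: algebra_simps)
    then show ?thesis using d_ge_3 by simp
  qed
  obtain w where w: "w \<in> nbs v" "visits_inf anb {(v, w)} (v, w) = 1"
    using nbrw_recurrent_arc[OF v] by blast
  have vw: "(v, w) \<in> arcs V E" using v w by (simp add: arcs_def)
  have "1 \<le> h (v, w)"
    unfolding h_def w(2)[symmetric] by (rule nbrw.visits_inf_mono_target[OF vw]) auto
  then have "h (v, w) = 1"
    using nbrw.visits_inf_le_1[OF vw, of "{v} \<times> UNIV"] by (simp add: h_def)
  moreover have "h (v, w) = c" using h_const v w by blast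
  moreover have "h a = c" using h_const a by (auto simp: arcs_def)
  ultimately show ?thesis by (simp add: h_def)
qed

end

end

section \<open>The laws of the walks\<close>

text \<open>For the index set \<open>{0..<n}\<close> the horizon \<open>up_to\<close> is exactly
  \<open>n\<close>, so the marginal of the limit is the composition of the first \<open>n\<close>
  kernels.\<close>

lemma (in Ionescu_Tulcea) nn_integral_lim:
  assumes f: "f \<in> borel_measurable (PiM {0..<n} M)"
  shows "(\<integral>\<^sup>+\<omega>. f (restrict \<omega> {0..<n}) \<partial>PF.lim) = (\<integral>\<^sup>+\<omega>. f \<omega> \<partial>C 0 n (\<lambda>_. undefined))"
proof -
  have "up_to {0..<n} \<le> n" by (simp add: up_to_iff)
  moreover have "n \<le> up_to {0..<n}" using up_to_less[of "{0..<n}" "n - 1"] by (cases n) auto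
  ultimately have "CI {0..<n} = C 0 n (\<lambda>_. undefined)"
    using distr_C[of n n "\<lambda>_. undefined" 0] by (simp add: CI_def)
  then have "C 0 n (\<lambda>_. undefined) = distr PF.lim (PiM {0..<n} M) (\<lambda>x. restrict x {0..<n})"
    by (simp add: distr_lim)
  moreover have "(\<lambda>x. restrict x {0..<n}) \<in> PF.lim \<rightarrow>\<^sub>M PiM {0..<n} M"
    by (auto intro!: measurable_restrict measurable_component_singleton simp: measurable_cong_sets[OF PF.sets_lim])
  ultimately show ?thesis using f by (simp add: nn_integral_distr)
qed

lemma (in Ionescu_Tulcea) nn_integral_lim_Suc:
  assumes f: "f \<in> borel_measurable (PiM {0..<Suc n} M)"
  shows "(\<integral>\<^sup>+\<omega>. f (restrict \<omega> {0..<Suc n}) \<partial>PF.lim) =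
    (\<integral>\<^sup>+\<omega>. \<integral>\<^sup>+x. f ((restrict \<omega> {0..<n})(n := x)) \<partial>P n (restrict \<omega> {0..<n}) \<partial>PF.lim)"
proof -
  let ?u = "\<lambda>_. undefined"
  have u: "?u \<in> space (PiM {0..<0} M)" by (simp add: space_PiM)
  have meas: "(\<lambda>\<omega>. \<integral>\<^sup>+x. f x \<partial>eP n \<omega>) \<in> borel_measurable (PiM {0..<n} M)"
    by (rule measurable_compose[OF measurable_eP nn_integral_measurable_subprob_algebra[OF f]])
  have "(\<integral>\<^sup>+\<omega>. f (restrict \<omega> {0..<Suc n}) \<partial>PF.lim) = (\<integral>\<^sup>+\<omega>. f \<omega> \<partial>(C 0 n ?u \<bind> eP n))"
    using nn_integral_lim[OF f] by simp
  also have "\<dots> = (\<integral>\<^sup>+\<omega>. \<integral>\<^sup>+x. f x \<partial>eP n \<omega> \<partial>C 0 n ?u)"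
    using f measurable_eP[of n] sets_C[OF u, of n]
    by (intro nn_integral_bind[where B = "PiM {0..<Suc n} M"]) (simp_all cong: measurable_cong_sets)
  also have "\<dots> = (\<integral>\<^sup>+\<omega>. \<integral>\<^sup>+x. f x \<partial>eP n (restrict \<omega> {0..<n}) \<partial>PF.lim)"
    using nn_integral_lim[OF meas] by simp
  also have "\<dots> = (\<integral>\<^sup>+\<omega>. \<integral>\<^sup>+x. f ((restrict \<omega> {0..<n})(n := x)) \<partial>P n (restrict \<omega> {0..<n}) \<partial>PF.lim)"
    by (intro nn_integral_cong nn_integral_eP f) (auto simp: PF.space_lim space_PiM)
  finally show ?thesis .
qed

locale discrete_process =
  fixes V :: "'a set" and K :: "nat \<Rightarrow> (nat \<Rightarrow> 'a) \<Rightarrow> 'a measure"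
  assumes countable_V: "countable V"
    and IT: "Ionescu_Tulcea K (\<lambda>_. count_space V)"
    and K_restrict: "\<And>n \<omega>. K n (restrict \<omega> {0..<n}) = K n \<omega>"
begin

sublocale Ionescu_Tulcea K "\<lambda>_. count_space V" by (rule IT)

lemma process_law_eq: "process_law V K = PF.lim"
  by (simp add: process_law_def)

lemma sets_process_law [measurable_cong]: "sets (process_law V K) = sets (PiM UNIV (\<lambda>_. count_space V))"
  by (simp add: process_law_eq PF.sets_lim)

lemma space_process_law: "\<omega> \<in> space (process_law V K) \<Longrightarrow> \<omega> t \<in> V"
  by (auto simp: process_law_eq PF.space_lim space_PiM)

lemma prob_space_process_law: "prob_space (process_law V K)"
proof
  have "emeasure (process_law V K) (space (process_law V K)) = (\<integral>\<^sup>+\<omega>. 1 \<partial>C 0 0 (\<lambda>_. undefined))"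
    using nn_integral_lim[of "\<lambda>_. 1" 0] by (simp add: process_law_eq)
  also have "\<dots> = 1"
    using prob_space.emeasure_space_1[OF prob_space_C[of "\<lambda>_. undefined" 0 0]] by (simp add: space_PiM)
  finally show "emeasure (process_law V K) (space (process_law V K)) = 1" .
qed

text \<open>Integration over the coordinate \<open>n\<close> given the past, written for whole
  trajectories since \<open>F\<close> and \<open>K n\<close> read only finite prefixes.
  \<open>F\<close> is measurable because a finite product of countable discrete spaces is
  discrete.\<close>

lemma nn_integral_process_law_step:
  fixes F :: "(nat \<Rightarrow> 'a) \<Rightarrow> ennreal"
  assumes F: "\<And>\<omega>. F (restrict \<omega> {0..<Suc n}) = F \<omega>"
  shows "(\<integral>\<^sup>+\<omega>. F \<omega> \<partial>process_law V K) = (\<integral>\<^sup>+\<omega>. \<integral>\<^sup>+x. F (fun_upd \<omega> n x) \<partial>K n \<omega> \<partial>process_law V K)"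
proof -
  have "PiM {0..<Suc n} (\<lambda>_. count_space V) = count_space (PiE {0..<Suc n} (\<lambda>_. V))"
    using countable_V by (intro count_space_PiM_finite) auto
  then have "F \<in> borel_measurable (PiM {0..<Suc n} (\<lambda>_. count_space V))" by simp
  from nn_integral_lim_Suc[OF this]
  have "(\<integral>\<^sup>+\<omega>. F \<omega> \<partial>process_law V K) =
    (\<integral>\<^sup>+\<omega>. \<integral>\<^sup>+x. F ((restrict \<omega> {0..<n})(n := x)) \<partial>K n \<omega> \<partial>process_law V K)"
    by (simp only: process_law_eq F K_restrict)
  moreover have "F ((restrict \<omega> {0..<n})(n := x)) = F (fun_upd \<omega> n x)" for \<omega> x
  proof -
    have "restrict (fun_upd \<omega> n x) {0..<Suc n} = (restrict \<omega> {0..<n})(n := x)" by (auto simp: restrict_def)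
    then show ?thesis using F[of "fun_upd \<omega> n x"] by simp
  qed
  ultimately show ?thesis by simp
qed

end

section \<open>Counting visits along a trajectory\<close>

definition visit_count :: "'a \<Rightarrow> nat \<Rightarrow> (nat \<Rightarrow> 'a) \<Rightarrow> nat" where
  "visit_count v n \<omega> = card {t. t < n \<and> \<omega> t = v}"

lemma visit_count_0: "visit_count v 0 \<omega> = 0"
  by (simp add: visit_count_def)

lemma visit_count_Suc: "visit_count v (Suc n) \<omega> = visit_count v n \<omega> + of_bool (\<omega> n = v)"
proof -
  have "{t. t < Suc n \<and> \<omega> t = v} = (if \<omega> n = v then insert n else id) {t. t < n \<and> \<omega> t = v}"
    by (auto simp: less_Suc_eq)
  then show ?thesis by (simp add: visit_count_def)
qed

lemma visit_count_cong: "(\<And>t. t < n \<Longrightarrow> \<omega> t = \<omega>' t) \<Longrightarrow> visit_count v n \<omega> = visit_count v n \<omega>'"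
  unfolding visit_count_def by (rule arg_cong[of _ _ card]) auto

text \<open>Reduces the tail event to countably many events that depend on finite prefixes.\<close>

lemma infinitely_many_visits_iff: "(\<exists>\<^sub>\<infinity>t. \<omega> t = v) \<longleftrightarrow> (\<forall>k. \<exists>n. k \<le> visit_count v n \<omega>)"
proof
  assume inf: "\<exists>\<^sub>\<infinity>t. \<omega> t = v"
  show "\<forall>k. \<exists>n. k \<le> visit_count v n \<omega>"
  proof
    fix k
    obtain T where T: "finite T" "card T = k" "T \<subseteq> {t. \<omega> t = v}"
      using infinite_arbitrarily_large inf by (metis INFM_iff_infinite)
    then obtain n where "\<forall>t\<in>T. t < n"
      using finite_nat_set_iff_bounded by blast
    with T have "card T \<le> visit_count v n \<omega>"
      unfolding visit_count_def by (intro card_mono) auto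
    with T show "\<exists>n. k \<le> visit_count v n \<omega>" by auto
  qed
next
  assume *: "\<forall>k. \<exists>n. k \<le> visit_count v n \<omega>"
  show "\<exists>\<^sub>\<infinity>t. \<omega> t = v"
  proof (rule ccontr)
    assume "\<not> (\<exists>\<^sub>\<infinity>t. \<omega> t = v)"
    then have fin: "finite {t. \<omega> t = v}" by (simp add: INFM_iff_infinite)
    obtain n where "Suc (card {t. \<omega> t = v}) \<le> visit_count v n \<omega>" using * by blast
    moreover have "visit_count v n \<omega> \<le> card {t. \<omega> t = v}"
      unfolding visit_count_def by (intro card_mono fin) auto
    ultimately show False by simp
  qed
qed

context discrete_process
begin

lemma measurable_visit_count [measurable]: "Measurable.pred (process_law V K) (\<lambda>\<omega>. k \<le> visit_count v n \<omega>)"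
proof (induction n arbitrary: k)
  case 0
  then show ?case by (simp add: visit_count_0)
next
  case (Suc n)
  have [measurable]: "Measurable.pred (process_law V K) (\<lambda>\<omega>. \<omega> n = v)"
  proof -
    have "(\<lambda>\<omega>. \<omega> n) \<in> process_law V K \<rightarrow>\<^sub>M count_space V"
      by (subst measurable_cong_sets[OF sets_process_law refl]) (rule measurable_component_singleton, simp)
    moreover have "(\<lambda>x. x = v) \<in> count_space V \<rightarrow>\<^sub>M count_space UNIV" by simp
    ultimately show ?thesis by (rule measurable_compose)
  qed
  have "(\<lambda>\<omega>. k \<le> visit_count v (Suc n) \<omega>)
      = (\<lambda>\<omega>. k \<le> visit_count v n \<omega> \<or> (\<omega> n = v \<and> k - 1 \<le> visit_count v n \<omega>))"
    by (auto simp: visit_count_Suc fun_eq_iff)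
  then show ?case using Suc by simp
qed

text \<open>By continuity from below \<open>p k\<close> is the probability of at least
  \<open>k\<close> visits in total; the intersection over \<open>k\<close> is countable.\<close>

lemma AE_infinitely_often_iff:
  assumes lim: "\<And>k. (\<lambda>n. emeasure (process_law V K) {\<omega> \<in> space (process_law V K). k \<le> visit_count v n \<omega>})
      \<longlonglongrightarrow> ennreal (p k)" and p: "\<And>k. 0 \<le> p k"
  shows "(AE \<omega> in process_law V K. \<exists>\<^sub>\<infinity>t. \<omega> t = v) \<longleftrightarrow> (\<forall>k. p k = 1)"
proof -
  let ?W = "process_law V K"
  interpret W: prob_space ?W by (rule prob_space_process_law)
  define A where "A k n = {\<omega> \<in> space ?W. k \<le> visit_count v n \<omega>}" for k n
  have A[measurable]: "A k n \<in> sets ?W" for k n by (simp add: A_def)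
  have inc: "incseq (A k)" for k
    by (intro incseq_SucI) (auto simp: A_def visit_count_Suc)
  have "(\<lambda>n. emeasure ?W (A k n)) \<longlonglongrightarrow> emeasure ?W (\<Union>n. A k n)" for k
    by (rule Lim_emeasure_incseq[OF _ inc]) auto
  then have em: "emeasure ?W (\<Union>n. A k n) = ennreal (p k)" for k
    using lim[of k] LIMSEQ_unique unfolding A_def by blast
  have "(AE \<omega> in ?W. \<exists>\<^sub>\<infinity>t. \<omega> t = v) \<longleftrightarrow> (\<forall>k. AE \<omega> in ?W. \<exists>n. k \<le> visit_count v n \<omega>)"
    by (simp add: infinitely_many_visits_iff AE_all_countable)
  also have "\<dots> \<longleftrightarrow> (\<forall>k. AE \<omega> in ?W. \<omega> \<in> (\<Union>n. A k n))"
    by (intro all_cong1 AE_cong) (simp add: A_def)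
  also have "\<dots> \<longleftrightarrow> (\<forall>k. W.prob (\<Union>n. A k n) = 1)"
    by (intro all_cong1 W.prob_eq_1[symmetric]) auto
  also have "\<dots> \<longleftrightarrow> (\<forall>k. p k = 1)"
    using em p by (simp add: measure_def)
  finally show ?thesis .
qed

text \<open>The conditional probability of at least \<open>k\<close> visits by a fixed time is a martingale.\<close>

lemma emeasure_visit_count:
  assumes step: "\<And>n (G :: nat \<Rightarrow> 's \<Rightarrow> real). (\<And>k y. 0 \<le> G k y) \<Longrightarrow>
      (\<integral>\<^sup>+\<omega>. G (visit_count v (Suc n) \<omega>) (Y (Suc n) \<omega>) \<partial>process_law V K)
      = (\<integral>\<^sup>+\<omega>. average nb (G (visit_count v (Suc n) \<omega>)) (Y n \<omega>) \<partial>process_law V K)"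
    and B: "\<And>n \<omega>. Y n \<omega> \<in> B \<longleftrightarrow> \<omega> n = v"
  shows "emeasure (process_law V K) {\<omega> \<in> space (process_law V K). k \<le> visit_count v n \<omega>}
    = (\<integral>\<^sup>+\<omega>. visits_prob nb B n k (Y 0 \<omega>) \<partial>process_law V K)"
proof -
  let ?W = "process_law V K"
  \<comment> \<open>Each step of the induction moves one time unit from the remaining horizon
    \<open>m\<close> to the observed past \<open>n\<close>. At \<open>m = 0\<close> truncated
    subtraction turns the integrand into the indicator of
    \<open>k \<le> visit_count v n \<omega>\<close>.\<close>
  have *: "(\<integral>\<^sup>+\<omega>. visits_prob nb B m (k - visit_count v n \<omega>) (Y n \<omega>) \<partial>?W)
    = (\<integral>\<^sup>+\<omega>. visits_prob nb B (n + m) k (Y 0 \<omega>) \<partial>?W)" for m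
  proof (induction n arbitrary: m)
    case (Suc n)
    have "(\<integral>\<^sup>+\<omega>. visits_prob nb B m (k - visit_count v (Suc n) \<omega>) (Y (Suc n) \<omega>) \<partial>?W)
      = (\<integral>\<^sup>+\<omega>. average nb (visits_prob nb B m (k - visit_count v (Suc n) \<omega>)) (Y n \<omega>) \<partial>?W)"
      by (rule step) (rule visits_prob_nonneg)
    also have "\<dots> = (\<integral>\<^sup>+\<omega>. visits_prob nb B (Suc m) (k - visit_count v n \<omega>) (Y n \<omega>) \<partial>?W)"
      by (simp add: visit_count_Suc B)
    finally show ?case using Suc.IH[of "Suc m"] by simp
  qed (simp add: visit_count_0)
  have "emeasure ?W {\<omega> \<in> space ?W. k \<le> visit_count v n \<omega>}
    = (\<integral>\<^sup>+\<omega>. indicator {\<omega> \<in> space ?W. k \<le> visit_count v n \<omega>} \<omega> \<partial>?W)"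
    by (subst nn_integral_indicator) auto
  also have "\<dots> = (\<integral>\<^sup>+\<omega>. visits_prob nb B 0 (k - visit_count v n \<omega>) (Y n \<omega>) \<partial>?W)"
    by (intro nn_integral_cong) (auto simp: indicator_def)
  finally show ?thesis using *[of 0] by simp
qed

end


lemma nn_integral_count_space_sum:
  assumes "finite Z" "Z \<subseteq> V" "\<And>x. 0 \<le> f x"
  shows "(\<integral>\<^sup>+x. ennreal (f x) * indicator Z x \<partial>count_space V) = ennreal (\<Sum>x\<in>Z. f x)"
proof -
  have "(\<integral>\<^sup>+x. ennreal (f x) * indicator Z x \<partial>count_space V) = (\<Sum>x\<in>Z. ennreal (f x) * emeasure (count_space V) {x})"
    using assms by (intro nn_integral_indicator_finite) auto
  also have "\<dots> = (\<Sum>x\<in>Z. ennreal (f x))"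
    using assms by (intro sum.cong) (auto simp: emeasure_count_space)
  finally show ?thesis using assms by (simp add: sum_ennreal)
qed

section \<open>The laws of the two walks in terms of the chains\<close>

context connected_regular_graph
begin

lemma countable_V: "countable V"
  using simple connected finite_nbs by (rule countable_vertices)

lemma nn_integral_srw_step:
  assumes "x \<in> V" "\<And>y. 0 \<le> f y"
  shows "(\<integral>\<^sup>+y. ennreal (f y) \<partial>srw_step V E x) = ennreal (average nbs f x)"
proof -
  have "(\<integral>\<^sup>+y. ennreal (f y) \<partial>srw_step V E x)
      = (\<integral>\<^sup>+y. ennreal (srw_prob E x y) * ennreal (f y) \<partial>count_space V)"
    unfolding srw_step_def point_measure_def by (subst nn_integral_density) auto
  also have "\<dots> = (\<integral>\<^sup>+y. ennreal (f y / d) * indicator (nbs x) y \<partial>count_space V)"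
    using assms card_nbs[OF assms(1)]
    by (intro nn_integral_cong)
       (auto simp: srw_prob_def deg_def neighbours_def indicator_def simp flip: ennreal_mult)
  also have "\<dots> = ennreal (\<Sum>y\<in>nbs x. f y / d)"
    using assms by (intro nn_integral_count_space_sum finite_nbs nbs_subset) auto
  also have "(\<Sum>y\<in>nbs x. f y / d) = average nbs f x"
    using card_nbs[OF assms(1)] by (simp add: average_def sum_divide_distrib)
  finally show ?thesis .
qed

lemma nn_integral_nbrw_step:
  assumes "y \<in> V" "\<And>a. 0 \<le> f a"
  shows "(\<integral>\<^sup>+z. ennreal (f (y, z)) \<partial>nbrw_step V E x y) = ennreal (average anb f (x, y))"
proof -
  let ?Z = "nbs y - {x}"
  have Z: "{z. {z, y} \<in> E \<and> z \<noteq> x} = ?Z" by (auto simp: neighbours_def insert_commute)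
  have fin: "finite ?Z" "?Z \<subseteq> V" "?Z \<noteq> {}"
    using finite_nbs[OF assms(1)] nbs_subset nbs_diff_nonempty[OF assms(1)] by auto
  have "(\<integral>\<^sup>+z. ennreal (f (y, z)) \<partial>nbrw_step V E x y)
      = (\<integral>\<^sup>+z. ennreal (f (y, z)) \<partial>uniform_measure (count_space V) ?Z)"
    using fin(3) by (simp add: nbrw_step_def Z)
  also have "\<dots> = (\<integral>\<^sup>+z. ennreal (f (y, z)) * indicator ?Z z \<partial>count_space V)
      / emeasure (count_space V) ?Z"
    using fin by (intro nn_integral_uniform_measure) auto
  also have "\<dots> = ennreal (\<Sum>z\<in>?Z. f (y, z)) / ennreal (real (card ?Z))"
    using fin assms(2)
    by (subst nn_integral_count_space_sum) (auto simp: emeasure_count_space ennreal_of_nat_eq_real_of_nat)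
  also have "\<dots> = ennreal ((\<Sum>z\<in>?Z. f (y, z)) / real (card ?Z))"
    using fin assms(2) by (intro divide_ennreal sum_nonneg) (auto simp: card_gt_0_iff)
  also have "(\<Sum>z\<in>?Z. f (y, z)) / real (card ?Z) = average anb f (x, y)"
    by (simp add: average_anb_eq)
  finally show ?thesis .
qed

context
  fixes u assumes u: "u \<in> V"
begin

interpretation S: discrete_process V "srw_kernel V E u"
proof (rule discrete_process.intro)
  show "countable V" by (rule countable_V)
  show "Ionescu_Tulcea (srw_kernel V E u) (\<lambda>_. count_space V)"
    using simple connected u finite_nbs nbs_nonempty by (intro Ionescu_Tulcea_srw) auto
  show "srw_kernel V E u n (restrict \<omega> {0..<n}) = srw_kernel V E u n \<omega>" for n \<omega>
    by (cases n) auto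
qed

interpretation N: discrete_process V "nbrw_kernel V E u"
proof (rule discrete_process.intro)
  show "countable V" by (rule countable_V)
  show "Ionescu_Tulcea (nbrw_kernel V E u) (\<lambda>_. count_space V)"
    using simple connected u finite_nbs nbs_nonempty by (intro Ionescu_Tulcea_nbrw) auto
  show "nbrw_kernel V E u n (restrict \<omega> {0..<n}) = nbrw_kernel V E u n \<omega>" for n \<omega>
    by (cases "(V, E, u, n, \<omega>)" rule: nbrw_kernel.cases) auto
qed

lemma emeasure_srw_visit_count:
  "emeasure (srw V E u) {\<omega> \<in> space (srw V E u). k \<le> visit_count v n \<omega>} = visits_prob nbs {v} n k u"
proof -
  have "emeasure (srw V E u) {\<omega> \<in> space (srw V E u). k \<le> visit_count v n \<omega>}
      = (\<integral>\<^sup>+\<omega>. visits_prob nbs {v} n k (\<omega> 0) \<partial>srw V E u)"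
    unfolding srw_def
  proof (rule S.emeasure_visit_count[where Y = "\<lambda>n \<omega>. \<omega> n"])
    fix n and G :: "nat \<Rightarrow> 'a \<Rightarrow> real" assume G: "\<And>k y. 0 \<le> G k y"
    have c: "visit_count v (Suc n) (fun_upd \<omega> (Suc n) x) = visit_count v (Suc n) \<omega>"
      "visit_count v (Suc n) (restrict \<omega> {0..<Suc (Suc n)}) = visit_count v (Suc n) \<omega>" for \<omega> x
      by (rule visit_count_cong; simp)+
    have "(\<integral>\<^sup>+\<omega>. G (visit_count v (Suc n) \<omega>) (\<omega> (Suc n)) \<partial>process_law V (srw_kernel V E u))
        = (\<integral>\<^sup>+\<omega>. \<integral>\<^sup>+x. G (visit_count v (Suc n) \<omega>) x \<partial>srw_step V E (\<omega> n) \<partial>process_law V (srw_kernel V E u))"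
      by (subst S.nn_integral_process_law_step[of _ "Suc n"]) (simp_all add: c)
    also have "\<dots> = (\<integral>\<^sup>+\<omega>. average nbs (G (visit_count v (Suc n) \<omega>)) (\<omega> n) \<partial>process_law V (srw_kernel V E u))"
      by (intro nn_integral_cong nn_integral_srw_step S.space_process_law G)
    finally show "(\<integral>\<^sup>+\<omega>. G (visit_count v (Suc n) \<omega>) (\<omega> (Suc n)) \<partial>process_law V (srw_kernel V E u))
      = (\<integral>\<^sup>+\<omega>. average nbs (G (visit_count v (Suc n) \<omega>)) (\<omega> n) \<partial>process_law V (srw_kernel V E u))" .
  qed simp
  also have "\<dots> = (\<integral>\<^sup>+\<omega>. \<integral>\<^sup>+x. visits_prob nbs {v} n k x \<partial>return (count_space V) u \<partial>srw V E u)"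
    unfolding srw_def by (subst S.nn_integral_process_law_step[of _ 0]) simp_all
  also have "\<dots> = visits_prob nbs {v} n k u"
    using u S.prob_space_process_law by (simp add: nn_integral_return srw_def prob_space.emeasure_space_1)
  finally show ?thesis .
qed

lemma emeasure_nbrw_visit_count:
  "emeasure (nbrw V E u) {\<omega> \<in> space (nbrw V E u). k \<le> visit_count v n \<omega>}
    = out_avg (visits_prob anb ({v} \<times> UNIV) n k) u"
proof -
  let ?r = "visits_prob anb ({v} \<times> UNIV) n k"
  have "emeasure (nbrw V E u) {\<omega> \<in> space (nbrw V E u). k \<le> visit_count v n \<omega>}
      = (\<integral>\<^sup>+\<omega>. ?r (\<omega> 0, \<omega> (Suc 0)) \<partial>nbrw V E u)"
    unfolding nbrw_def
  \<comment> \<open>The arc looks one step ahead: passing to \<open>Y (Suc n)\<close> draws the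
    position at time \<open>n + 2\<close>, which does not affect
    \<open>visit_count v (Suc n)\<close>.\<close>
  proof (rule N.emeasure_visit_count[where Y = "\<lambda>n \<omega>. (\<omega> n, \<omega> (Suc n))"])
    fix n and G :: "nat \<Rightarrow> 'a \<times> 'a \<Rightarrow> real" assume G: "\<And>k y. 0 \<le> G k y"
    have c: "visit_count v (Suc n) (fun_upd \<omega> (Suc (Suc n)) x) = visit_count v (Suc n) \<omega>"
      "visit_count v (Suc n) (restrict \<omega> {0..<Suc (Suc (Suc n))}) = visit_count v (Suc n) \<omega>" for \<omega> x
      by (rule visit_count_cong; simp)+
    have "(\<integral>\<^sup>+\<omega>. G (visit_count v (Suc n) \<omega>) (\<omega> (Suc n), \<omega> (Suc (Suc n))) \<partial>process_law V (nbrw_kernel V E u))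
        = (\<integral>\<^sup>+\<omega>. \<integral>\<^sup>+x. G (visit_count v (Suc n) \<omega>) (\<omega> (Suc n), x) \<partial>nbrw_step V E (\<omega> n) (\<omega> (Suc n))
            \<partial>process_law V (nbrw_kernel V E u))"
      by (subst N.nn_integral_process_law_step[of _ "Suc (Suc n)"]) (simp_all add: c)
    also have "\<dots> = (\<integral>\<^sup>+\<omega>. average anb (G (visit_count v (Suc n) \<omega>)) (\<omega> n, \<omega> (Suc n)) \<partial>process_law V (nbrw_kernel V E u))"
      by (intro nn_integral_cong nn_integral_nbrw_step N.space_process_law G)
    finally show "(\<integral>\<^sup>+\<omega>. G (visit_count v (Suc n) \<omega>) (\<omega> (Suc n), \<omega> (Suc (Suc n))) \<partial>process_law V (nbrw_kernel V E u))
      = (\<integral>\<^sup>+\<omega>. average anb (G (visit_count v (Suc n) \<omega>)) (\<omega> n, \<omega> (Suc n)) \<partial>process_law V (nbrw_kernel V E u))" .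
  qed simp
  also have "\<dots> = (\<integral>\<^sup>+\<omega>. \<integral>\<^sup>+x. ?r (\<omega> 0, x) \<partial>srw_step V E (\<omega> 0) \<partial>nbrw V E u)"
    unfolding nbrw_def by (subst N.nn_integral_process_law_step[of _ "Suc 0"]) simp_all
  also have "\<dots> = (\<integral>\<^sup>+\<omega>. out_avg ?r (\<omega> 0) \<partial>nbrw V E u)"
    unfolding nbrw_def out_avg_def
    by (intro nn_integral_cong nn_integral_srw_step N.space_process_law visits_prob_nonneg)
  also have "\<dots> = (\<integral>\<^sup>+\<omega>. \<integral>\<^sup>+x. out_avg ?r x \<partial>return (count_space V) u \<partial>nbrw V E u)"
    unfolding nbrw_def by (subst N.nn_integral_process_law_step[of _ 0]) simp_all
  also have "\<dots> = out_avg ?r u"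
    using u N.prob_space_process_law by (simp add: nn_integral_return nbrw_def prob_space.emeasure_space_1)
  finally show ?thesis .
qed

lemma recurrent_vertex_srw_iff: "recurrent_vertex (srw V E) u \<longleftrightarrow> visits_inf nbs {u} u = 1"
proof -
  have "recurrent_vertex (srw V E) u \<longleftrightarrow> (\<forall>k. visits_lim nbs {u} k u = 1)"
    unfolding recurrent_vertex_def srw_def
  proof (rule S.AE_infinitely_often_iff)
    show "(\<lambda>n. emeasure (process_law V (srw_kernel V E u))
        {\<omega> \<in> space (process_law V (srw_kernel V E u)). k \<le> visit_count u n \<omega>})
        \<longlonglongrightarrow> ennreal (visits_lim nbs {u} k u)" for k
      using emeasure_srw_visit_count[of k u] srw.visits_lim[OF u, of "{u}" k]
      by (simp add: srw_def tendsto_ennrealI)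
  qed (rule srw.visits_lim_nonneg[OF u])
  then show ?thesis by (simp add: srw.visits_inf_eq_1_iff[OF u])
qed

text \<open>The first arc is uniform, and an average of numbers at most 1 equals 1 only if all of
  them do.\<close>

lemma recurrent_vertex_nbrw_iff:
  "recurrent_vertex (nbrw V E) u \<longleftrightarrow> (\<forall>w\<in>nbs u. visits_inf anb ({u} \<times> UNIV) (u, w) = 1)"
proof -
  have arc: "(u, w) \<in> arcs V E" if "w \<in> nbs u" for w using u that by (simp add: arcs_def)
  have "recurrent_vertex (nbrw V E) u \<longleftrightarrow> (\<forall>k. out_avg (visits_lim anb ({u} \<times> UNIV) k) u = 1)"
    unfolding recurrent_vertex_def nbrw_def
  proof (rule N.AE_infinitely_often_iff)
    show "(\<lambda>n. emeasure (process_law V (nbrw_kernel V E u))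
        {\<omega> \<in> space (process_law V (nbrw_kernel V E u)). k \<le> visit_count u n \<omega>})
        \<longlonglongrightarrow> ennreal (out_avg (visits_lim anb ({u} \<times> UNIV) k) u)" for k
      using emeasure_nbrw_visit_count[of k u] unfolding nbrw_def out_avg_def
      by (auto intro!: tendsto_ennrealI average_tendsto nbrw.visits_lim arc)
  qed (auto simp: out_avg_def intro!: average_nonneg nbrw.visits_lim_nonneg arc)
  also have "\<dots> \<longleftrightarrow> (\<forall>k. \<forall>w\<in>nbs u. visits_lim anb ({u} \<times> UNIV) k (u, w) = 1)"
    unfolding out_avg_def
    using srw.average_eqI[OF u] srw.average_eq_upper[OF u] nbrw.visits_lim_le_1[OF arc]
    by (intro all_cong1) (metis (no_types, lifting))
  also have "\<dots> \<longleftrightarrow> (\<forall>w\<in>nbs u. visits_inf anb ({u} \<times> UNIV) (u, w) = 1)"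
    using nbrw.visits_inf_eq_1_iff[OF arc] by blast
  finally show ?thesis .
qed

end

text \<open>For the reverse implication, a vertex that is not recurrent for the simple walk would
  give the arcs out of it the value 0 by \<open>nbrw_transient\<close>, against the value 1 from
  recurrence.\<close>

lemma srw_recurrent_iff_nbrw_recurrent:
  "recurrent_walk V (srw V E) \<longleftrightarrow> recurrent_walk V (nbrw V E)"
proof
  assume "recurrent_walk V (srw V E)"
  then have "visits_inf nbs {v} v = 1" if "v \<in> V" for v
    using that by (simp add: recurrent_walk_def recurrent_vertex_srw_iff)
  from nbrw_recurrent[OF this] show "recurrent_walk V (nbrw V E)"
    by (auto simp: recurrent_walk_def recurrent_vertex_nbrw_iff arcs_def)
next
  assume nb: "recurrent_walk V (nbrw V E)"
  have "visits_inf nbs {v} v = 1" if v: "v \<in> V" for v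
  proof (rule ccontr)
    assume *: "visits_inf nbs {v} v \<noteq> 1"
    obtain w where w: "w \<in> nbs v" using nbs_nonempty[OF v] by blast
    have "visits_inf anb ({v} \<times> UNIV) (v, w) = 0"
      using nbrw_transient[OF v *] v w by (simp add: arcs_def)
    moreover have "visits_inf anb ({v} \<times> UNIV) (v, w) = 1"
      using nb v w by (simp add: recurrent_walk_def recurrent_vertex_nbrw_iff)
    ultimately show False by simp
  qed
  then show "recurrent_walk V (srw V E)"
    by (simp add: recurrent_walk_def recurrent_vertex_srw_iff)
qed

end

theorem proposition1p1:
  fixes V :: "'a set" and E :: "'a set set" and d :: nat
  assumes "simple_graph V E"
    and "d \<ge> 3"
    and "regular_graph V E d"
    and "connected_graph V E"
  shows "recurrent_walk V (srw V E) \<longleftrightarrow> recurrent_walk V (nbrw V E)"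
proof -
  interpret connected_regular_graph V E d
    using assms by unfold_locales
  show ?thesis by (rule srw_recurrent_iff_nbrw_recurrent)
qed

end
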